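(* Let $n\geq 3$. The parabolic subgroups $Q_\emptyset$, $Q_1$ and $Q_2$ of $SO^0(2,n)$ act isometrically on $AdS^{n+1}$ with cohomogeneity zero. Furthermore, the group $Q_2$ acts transitively on $AdS^{n+1}$. The orbit foliations induced by $Q_\emptyset$, $Q_1$ and $AN$ coincide, and are given by $$\mathcal{F}=O_+\cup O_-\cup\bar O_+\cup\bar O_-$$ (that is, the orbits are exactly the four sets $O_+,O_-,\bar O_+,\bar O_-$), where $$O_+=\bigcup_{s>0}O_s,\quad O_-=\bigcup_{s<0}O_s,\quad \bar O_+=\bigcup_{r>0}\bar O_r,\quad \bar O_-=\bigcup_{r<0}\bar O_r.$$
   Context: $\mathbb{R}^{2,n}$ is $\mathbb{R}^{n+2}$ with coordinates $x_1,\dots,x_{n+2}$ and scalar product $\langle x,y\rangle=-x_1y_1-x_2y_2+x_3y_3+\dots+x_{n+2}y_{n+2}$; $AdS^{n+1}=\{x\in\mathbb{R}^{2,n}:\langle x,x\rangle=-1\}$. $SO^0(2,n)$ is the identity component of the group of determinant 1 linear isometries of $\mathbb{R}^{2,n}$, acting naturally on $AdS^{n+1}$; its Lie algebra is $\mathfrak{g}=\mathfrak{so}(2,n)$. Let $\mathfrak{k}\cong\mathfrak{so}(2)\oplus\mathfrak{so}(n)$ be the subalgebra of skew-symmetric matrices in $\mathfrak{g}$, and let $\mathfrak{a}=\{H_{a,b}:a,b\in\mathbb{R}\}$, where $H_{a,b}$ is the matrix whose only possibly nonzero entries are $(1,3)$ and $(3,1)$, equal to $a$, and $(2,4)$ and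 $(4,2)$, equal to $b$. For $\lambda\in\mathfrak{a}^*$ put $\mathfrak{g}_\lambda=\{X\in\mathfrak{g}:[H,X]=\lambda(H)X\ \forall H\in\mathfrak{a}\}$. With $\alpha_1(H_{a,b})=-a+b$ and $\alpha_2(H_{a,b})=a$, the restricted roots are $\pm\alpha_1,\pm\alpha_2,\pm(\alpha_1+\alpha_2),\pm(\alpha_1+2\alpha_2)$, the positive ones being $\alpha_1,\alpha_2,\alpha_1+\alpha_2,\alpha_1+2\alpha_2$. Put $\mathfrak{n}=\mathfrak{g}_{\alpha_1}\oplus\mathfrak{g}_{\alpha_2}\oplus\mathfrak{g}_{\alpha_1+\alpha_2}\oplus\mathfrak{g}_{\alpha_1+2\alpha_2}$. Explicitly, $\mathfrak{n}$ consists of the matrices (block sizes $1,1,1,1,n-2$) $$\begin{pmatrix} 0 & b+a & 0 & -b-a & v^{\top}\\ -b-a & 0 & -b+a & 0 & w^{\top}\\ 0 & -b+a & 0 & b-a & v^{\top}\\ -b-a & 0 & -b+a & 0 & w^{\top}\\ v & w & -v & -w & 0 \end{pmatrix},\qquad a,b\in\mathbb{R},\ v,w\in\mathbb{R}^{n-2}.$$ For a root $\lambda$, $\mathfrak{g}_{-\lambda}=\theta\mathfrak{g}_\lambda$ with $\theta(X)=-X^{\top}$. Also $\mathfrak{g}_0=\mathfrak{k}_0\oplus\mathfrak{a}$ with $\mathfrak{k}_0=\mathfrak{g}_0\cap\mathfrak{k}\cong\mathfrak{so}(n-2)$. $A$ and $N$ are the connected Lie subgroups of $SO^0(2,n)$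 with Lie algebras $\mathfrak{a}$ and $\mathfrak{n}$. The (up to conjugacy, proper) parabolic subalgebras of $\mathfrak{g}$ are $$\mathfrak{q}_\emptyset=\mathfrak{k}_0\oplus\mathfrak{a}\oplus\mathfrak{n},\qquad \mathfrak{q}_1=\mathfrak{q}_\emptyset\oplus\mathfrak{g}_{-\alpha_2},\qquad \mathfrak{q}_2=\mathfrak{q}_\emptyset\oplus\mathfrak{g}_{-\alpha_1},$$ and $Q_\emptyset,Q_1,Q_2$ are the connected Lie subgroups of $SO^0(2,n)$ with these Lie algebras. For $r\neq 0$, $\bar O_r$ denotes the $N$-orbit through a point $p\in AdS^{n+1}$ with $p_2-p_4=r$; for $s\neq 0$, $O_s$ denotes the $N$-orbit through a point $p\in AdS^{n+1}$ with $p_2=p_4$ and $p_1-p_3=s$ (these orbits depend only on $r$, respectively $s$). An isometric action has cohomogeneity zero if the minimum codimension of its orbits is zero (this does not require transitivity). *)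

theory Defs
  imports
    "HOL-Analysis.Analysis"
    "HOL-Algebra.Generated_Groups"
    "HOL-Algebra.Group_Action"
begin

text \<open>
  The index set of the coordinates of \<open>\<real>\<^sup>2\<^sup>,\<^sup>n\<close>: four distinguished indices, followed by the
  \<open>n - 2\<close> remaining ones (block sizes \<open>1, 1, 1, 1, n - 2\<close>). Thus \<open>x\<^sub>1, x\<^sub>2, x\<^sub>3, x\<^sub>4\<close> are
  \<open>x $ I1, x $ I2, x $ I3, x $ I4\<close>, the coordinates \<open>x\<^sub>5, x\<^sub>6, ...\<close> are the \<open>x $ Rest j\<close> with
  \<open>j :: 'm\<close>, and \<open>n = CARD('m) + 2\<close>.
\<close>

datatype 'm idx = I1 | I2 | I3 | I4 | Rest 'm

lemma UNIV_idx: "(UNIV :: 'm idx set) = {I1, I2, I3, I4} \<union> range Rest"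
proof (intro equalityI subsetI)
  fix x :: "'m idx"
  show "x \<in> {I1, I2, I3, I4} \<union> range Rest"
    by (cases x) simp_all
qed simp

instance idx :: (finite) finite
  by standard (simp add: UNIV_idx)

lemma CARD_idx: "CARD('m::finite idx) = CARD('m) + 4"
proof -
  have "card (range (Rest :: 'm \<Rightarrow> 'm idx)) = CARD('m)"
    by (rule card_image) (simp add: inj_def)
  moreover have "{I1, I2, I3, I4} \<inter> range (Rest :: 'm \<Rightarrow> 'm idx) = {}"
    by auto
  ultimately show ?thesis
    by (simp add: UNIV_idx card_Un_disjoint)
qed

type_synonym 'm vec2n = "real ^ 'm idx"
type_synonym 'm mat2n = "real ^ 'm idx ^ 'm idx"


section \<open>Anti-de Sitter space and its isometries\<close>

definition sprod :: "'m::finite vec2n \<Rightarrow> 'm vec2n \<Rightarrow> real" where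
  "sprod x y = - x $ I1 * y $ I1 - x $ I2 * y $ I2 + x $ I3 * y $ I3 + x $ I4 * y $ I4
     + (\<Sum>j\<in>UNIV. x $ Rest j * y $ Rest j)"

definition AdS :: "'m::finite vec2n set" where
  "AdS = {x. sprod x x = - 1}"

definition SO2n :: "'m::finite mat2n set" where
  "SO2n = {g. det g = 1 \<and> (\<forall>x y. sprod (g *v x) (g *v y) = sprod x y)}"

definition SO0_group :: "'m::finite mat2n monoid" where
  "SO0_group = \<lparr>carrier = connected_component_set SO2n (mat 1), monoid.mult = (**), one = mat 1\<rparr>"

abbreviation subgrp :: "'m::finite mat2n set \<Rightarrow> 'm mat2n monoid" where
  "subgrp G \<equiv> SO0_group\<lparr>carrier := G\<rparr>"

text \<open>The restriction makes each \<open>AdS_act g\<close> an extensional function, as required by \<open>BijGroup\<close>.\<close>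

definition AdS_act :: "'m::finite mat2n \<Rightarrow> 'm vec2n \<Rightarrow> 'm vec2n" where
  "AdS_act g = restrict (\<lambda>x. g *v x) AdS"

text \<open>
  Velocities at \<open>p\<close> of the \<open>C\<^sup>1\<close> curves that run inside \<open>S\<close>. For \<open>AdS\<close>, and for an
  orbit of a connected Lie group (which may be merely immersed), this is the tangent space at \<open>p\<close>.
\<close>

definition tangent_space :: "'m::finite vec2n set \<Rightarrow> 'm vec2n \<Rightarrow> 'm vec2n set" where
  "tangent_space S p = {v. \<exists>\<gamma> \<epsilon>. 0 < \<epsilon> \<and> \<gamma> C1_differentiable_on {-\<epsilon><..<\<epsilon>} \<and> \<gamma> ` {-\<epsilon><..<\<epsilon>} \<subseteq> S
     \<and> \<gamma> 0 = p \<and> (\<gamma> has_vector_derivative v) (at (0::real))}"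

text \<open>
  Isometries for the Lorentzian metric that \<open>sprod\<close> induces on \<open>AdS\<close>. The derivative of \<open>f\<close>
  within \<open>AdS\<close> is unique only on the tangent spaces, which are all that is used.
\<close>

definition AdS_isometry :: "('m::finite vec2n \<Rightarrow> 'm vec2n) \<Rightarrow> bool" where
  "AdS_isometry f \<longleftrightarrow> bij_betw f AdS AdS \<and>
     (\<exists>D :: 'm vec2n \<Rightarrow> 'm mat2n. continuous_on AdS D \<and>
       (\<forall>p\<in>AdS. (f has_derivative (\<lambda>v. D p *v v)) (at p within AdS) \<and>
         (\<forall>u\<in>tangent_space AdS p. \<forall>v\<in>tangent_space AdS p.
            sprod (D p *v u) (D p *v v) = sprod u v)))"

definition acts_isometrically :: "'m::finite mat2n set \<Rightarrow> bool" where
  "acts_isometrically G \<longleftrightarrow> group_action (subgrp G) AdS AdS_act \<and> (\<forall>g\<in>G. AdS_isometry (AdS_act g))"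

definition orbit_codim :: "'m::finite mat2n set \<Rightarrow> 'm vec2n \<Rightarrow> nat" where
  "orbit_codim G p =
     dim (tangent_space AdS p) - dim (tangent_space (orbit (subgrp G) AdS_act p) p)"

definition cohomogeneity :: "'m::finite mat2n set \<Rightarrow> nat" where
  "cohomogeneity G = (INF p\<in>AdS. orbit_codim G p)"


section \<open>The Lie algebra and its restricted root spaces\<close>

definition bracket :: "'m::finite mat2n \<Rightarrow> 'm mat2n \<Rightarrow> 'm mat2n" where
  "bracket X Y = X ** Y - Y ** X"

definition so2n :: "'m::finite mat2n set" where
  "so2n = {X. \<forall>x y. sprod (X *v x) y + sprod x (X *v y) = 0}"

definition lie_k :: "'m::finite mat2n set" where
  "lie_k = {X \<in> so2n. transpose X = - X}"

definition Hmat :: "real \<Rightarrow> real \<Rightarrow> 'm::finite mat2n" where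
  "Hmat a b = (\<chi> i j. if (i, j) \<in> {(I1, I3), (I3, I1)} then a
                      else if (i, j) \<in> {(I2, I4), (I4, I2)} then b else 0)"

definition lie_a :: "'m::finite mat2n set" where
  "lie_a = {Hmat a b | a b. True}"

text \<open>
  Functionals on \<open>\<aa>\<close> are written as functions on all matrices; only their values on \<open>lie_a\<close> matter.
\<close>

definition alpha1 :: "'m::finite mat2n \<Rightarrow> real" where
  "alpha1 H = - H $ I1 $ I3 + H $ I2 $ I4"

definition alpha2 :: "'m::finite mat2n \<Rightarrow> real" where
  "alpha2 H = H $ I1 $ I3"

lemma alpha_Hmat: "alpha1 (Hmat a b) = - a + b" "alpha2 (Hmat a b) = a"
  by (simp_all add: alpha1_def alpha2_def Hmat_def)

definition root_space :: "('m::finite mat2n \<Rightarrow> real) \<Rightarrow> 'm mat2n set" where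
  "root_space \<mu> = {X \<in> so2n. \<forall>H\<in>lie_a. bracket H X = \<mu> H *\<^sub>R X}"

definition lie_k0 :: "'m::finite mat2n set" where
  "lie_k0 = root_space (\<lambda>H. 0) \<inter> lie_k"

text \<open>Sums of subspaces are elementwise sums of sets.\<close>

definition lie_n :: "'m::finite mat2n set" where
  "lie_n = root_space alpha1 + root_space alpha2
     + root_space (\<lambda>H. alpha1 H + alpha2 H) + root_space (\<lambda>H. alpha1 H + 2 * alpha2 H)"

definition lie_q0 :: "'m::finite mat2n set" where
  "lie_q0 = lie_k0 + lie_a + lie_n"

definition lie_q1 :: "'m::finite mat2n set" where
  "lie_q1 = lie_q0 + root_space (\<lambda>H. - alpha2 H)"

definition lie_q2 :: "'m::finite mat2n set" where
  "lie_q2 = lie_q0 + root_space (\<lambda>H. - alpha1 H)"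


section \<open>Connected Lie subgroups\<close>

definition mexp :: "'m::finite mat2n \<Rightarrow> 'm mat2n" where
  "mexp X = (\<Sum>k. (1 / fact k) *\<^sub>R (((**) X ^^ k) (mat 1)))"

text \<open>
  The connected Lie subgroup with Lie algebra \<open>\<hh> \<subseteq> so2n\<close> is the subgroup generated by \<open>exp \<hh>\<close>.
\<close>

definition connected_Lie_subgroup :: "'m::finite mat2n set \<Rightarrow> 'm mat2n set" where
  "connected_Lie_subgroup \<hh> = generate SO0_group (mexp ` \<hh>)"

definition grp_A :: "'m::finite mat2n set" where
  "grp_A = connected_Lie_subgroup lie_a"

definition grp_N :: "'m::finite mat2n set" where
  "grp_N = connected_Lie_subgroup lie_n"

definition grp_AN :: "'m::finite mat2n set" where
  "grp_AN = grp_A <#>\<^bsub>SO0_group\<^esub> grp_N"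

definition grp_Q0 :: "'m::finite mat2n set" where
  "grp_Q0 = connected_Lie_subgroup lie_q0"

definition grp_Q1 :: "'m::finite mat2n set" where
  "grp_Q1 = connected_Lie_subgroup lie_q1"

definition grp_Q2 :: "'m::finite mat2n set" where
  "grp_Q2 = connected_Lie_subgroup lie_q2"


section \<open>The orbits of \<open>N\<close>\<close>

text \<open>
  For \<open>r \<noteq> 0\<close> and \<open>s \<noteq> 0\<close> the points described below exist and all lie in one orbit, so that the
  definite descriptions denote; they are not used for \<open>r = 0\<close> or \<open>s = 0\<close>.
\<close>

definition Obar :: "real \<Rightarrow> 'm::finite vec2n set" where
  "Obar r = (THE S. \<exists>p\<in>AdS. p $ I2 - p $ I4 = r \<and> S = orbit (subgrp grp_N) AdS_act p)"

definition Orb :: "real \<Rightarrow> 'm::finite vec2n set" where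
  "Orb s = (THE S. \<exists>p\<in>AdS. p $ I2 = p $ I4 \<and> p $ I1 - p $ I3 = s
                      \<and> S = orbit (subgrp grp_N) AdS_act p)"

definition O_plus :: "'m::finite vec2n set" where "O_plus = (\<Union>s\<in>{0<..}. Orb s)"
definition O_minus :: "'m::finite vec2n set" where "O_minus = (\<Union>s\<in>{..<0}. Orb s)"
definition Obar_plus :: "'m::finite vec2n set" where "Obar_plus = (\<Union>r\<in>{0<..}. Obar r)"
definition Obar_minus :: "'m::finite vec2n set" where "Obar_minus = (\<Union>r\<in>{..<0}. Obar r)"

end

theory Submission
  imports Defs
begin

text \<open>
  In the light-cone coordinates \<open>u1 = x\<^sub>1 - x\<^sub>3\<close>, \<open>w1 = x\<^sub>1 + x\<^sub>3\<close>, \<open>u2 = x\<^sub>2 - x\<^sub>4\<close>, \<open>w2 = x\<^sub>2 + x\<^sub>4\<close> and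
  \<open>z = (x\<^sub>5, x\<^sub>6, ...)\<close>, anti-de Sitter space is given by \<open>u1 w1 + u2 w2 = 1 + |z|\<^sup>2\<close>. In particular
  \<open>u1\<close> and \<open>u2\<close> never vanish together on it.

  The abelian algebra \<open>\<aa>\<close> acts diagonally, and a root vector shifts the weights of linear functionals.
  Comparing weights shows that \<open>\<nn>\<close> annihilates the functional \<open>u2\<close> and, on the hyperplane \<open>u2 = 0\<close>, also
  \<open>u1\<close>. So \<open>N\<close> preserves \<open>u2\<close> and, where \<open>u2 = 0\<close>, the value of \<open>u1\<close>. Conversely, the explicit
  exponentials of root vectors move every point to a normal form that depends only on these values
  (\<open>N_reaches_base_point\<close>). Hence they classify the \<open>N\<close>-orbits, which are the sets \<open>Obar r\<close> and \<open>Orb s\<close>.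

  Since \<open>A\<close> rescales \<open>u1\<close> and \<open>u2\<close> by arbitrary positive factors, two points of \<open>AdS\<close> lie in
  one \<open>AN\<close>-orbit if they have the same sign of \<open>u2\<close> and, where \<open>u2 = 0\<close>, the same sign of \<open>u1\<close>
  (\<open>AN_transitive_on_level_signs\<close>). These signs are still preserved by the larger group \<open>Q\<^sub>1\<close>
  (\<open>Q1_preserves_level_sign\<close>): its Lie algebra acts on \<open>u2\<close> by a scalar, and \<open>u1\<close> cannot change its sign
  along a curve in \<open>AdS\<close> on which \<open>u2 = 0\<close>. As \<open>AN \<subseteq> Q\<^sub>\<emptyset> \<subseteq> Q\<^sub>1\<close>, the three groups have the same four
  orbits. The additional root space of \<open>\<qq>\<^sub>2\<close> generates, together with that of \<open>alpha1\<close>, a group that acts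
  on the pair \<open>(u1, u2)\<close> transitively away from the origin, which makes \<open>Q\<^sub>2\<close> transitive
  (\<open>Q2_transitive\<close>).

  Each of the parabolic groups therefore has an orbit that is open in \<open>AdS\<close>, and such an orbit has
  codimension zero. That exponentials of \<open>so2n\<close> lie in the identity component, and thus generate subgroups
  acting by isometries, follows by differentiating the scalar product along one-parameter groups
  (\<open>sprod_mexp\<close>) and by continuity of the determinant (\<open>mexp_in_SO0\<close>).
\<close>


section \<open>The matrix exponential\<close>

abbreviation mpow :: "'m::finite mat2n \<Rightarrow> nat \<Rightarrow> 'm mat2n" where
  "mpow X k \<equiv> ((**) X ^^ k) (mat 1)"

lemma mpow_mult_vec: "mpow X k *v x = (((*v) X) ^^ k) x"
  by (induction k) (simp_all add: matrix_vector_mul_assoc [symmetric])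

lemma mpow_scaleR: "mpow (t *\<^sub>R X) k = t ^ k *\<^sub>R mpow X k"
  by (induction k)
    (simp_all add: matrix_scalar_ac scalar_matrix_assoc [symmetric] mult.commute)

text \<open>
  This makes every entry of \<open>mexp (t X)\<close> an everywhere convergent power series in \<open>t\<close>, so that
  differentiation can be done entry by entry with the theory of real power series.
\<close>

lemma mpow_entry_bound: "\<bar>mpow X k $ i $ j\<bar> \<le> onorm ((*v) X) ^ k"
proof -
  have *: "norm ((((*v) X) ^^ k) x) \<le> onorm ((*v) X) ^ k * norm x" for x
  proof (induction k)
    case (Suc k)
    have "norm (X *v ((((*v) X) ^^ k) x)) \<le> onorm ((*v) X) * norm ((((*v) X) ^^ k) x)"
      by (rule onorm) simp
    also have "\<dots> \<le> onorm ((*v) X) * (onorm ((*v) X) ^ k * norm x)"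
      by (intro mult_left_mono Suc onorm_pos_le) simp
    finally show ?case
      by (simp add: mult.assoc)
  qed simp
  have "mpow X k $ i $ j = (mpow X k *v axis j 1) $ i"
    by (simp add: matrix_vector_mul_component inner_axis)
  also have "\<bar>\<dots>\<bar> \<le> norm (mpow X k *v axis j 1)"
    by (rule component_le_norm_cart)
  also have "\<dots> \<le> onorm ((*v) X) ^ k"
    using *[of "axis j 1"] by (simp add: mpow_mult_vec)
  finally show ?thesis .
qed

lemma summable_mexp_entry: "summable (\<lambda>k. mpow X k $ i $ j / fact k * t ^ k)"
proof (rule summable_comparison_test')
  show "summable (\<lambda>k. inverse (fact k) * (onorm ((*v) X) * \<bar>t\<bar>) ^ k)"
    by (rule summable_exp)
  show "norm (mpow X k $ i $ j / fact k * t ^ k) \<le> inverse (fact k) * (onorm ((*v) X) * \<bar>t\<bar>) ^ k"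
    for k
    using mult_right_mono[OF mpow_entry_bound[where X = X and k = k and i = i and j = j], of "\<bar>t\<bar> ^ k / fact k"]
    by (simp add: abs_mult power_abs power_mult_distrib field_simps)
qed

lemma mexp_sums: "(\<lambda>k. (1 / fact k) *\<^sub>R mpow X k) sums mexp X"
proof -
  have "(\<lambda>k. (1 / fact k) *\<^sub>R mpow X k) sums (\<chi> i j. \<Sum>k. mpow X k $ i $ j / fact k)"
    unfolding sums_def
  proof (intro vec_tendstoI)
    fix i j
    show "((\<lambda>n. (\<Sum>k<n. (1 / fact k) *\<^sub>R mpow X k) $ i $ j)
             \<longlongrightarrow> (\<chi> i j. \<Sum>k. mpow X k $ i $ j / fact k) $ i $ j) sequentially"
      using summable_LIMSEQ[OF summable_mexp_entry[of X i j 1]] by simp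
  qed
  then show ?thesis
    unfolding mexp_def by (rule sums_summable [THEN summable_sums])
qed

lemma mexp_linear_sums:
  assumes "linear \<phi>"
  shows "(\<lambda>k. (1 / fact k) *\<^sub>R \<phi> (mpow X k)) sums (\<phi> (mexp X) :: 'b::real_normed_vector)"
  using bounded_linear.sums[OF linear_conv_bounded_linear[THEN iffD1, OF assms] mexp_sums[of X]]
  by (simp add: linear_scale[OF assms])

lemma mexp_entry: "mexp (t *\<^sub>R X) $ i $ j = (\<Sum>k. mpow X k $ i $ j / fact k * t ^ k)"
proof -
  have "(\<lambda>k. (1 / fact k) *\<^sub>R (mpow (t *\<^sub>R X) k $ i $ j)) sums (mexp (t *\<^sub>R X) $ i $ j)"
    by (rule mexp_linear_sums) (simp add: linear_iff)
  then show ?thesis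
    by (simp add: sums_unique mpow_scaleR mult.commute)
qed

lemma mexp_0: "mexp 0 = mat 1"
proof -
  have "mexp 0 $ i $ j = mat 1 $ i $ j" for i j :: "'a idx"
    using mexp_entry[of 0 0 i j] powser_zero[of "\<lambda>k. mpow 0 k $ i $ j / fact k"] by simp
  then show ?thesis
    by (simp add: vec_eq_iff)
qed

lemma mexp_entry_deriv:
  "((\<lambda>t. mexp (t *\<^sub>R X) $ i $ j) has_field_derivative (X ** mexp (t *\<^sub>R X)) $ i $ j) (at t)"
proof -
  have *: "diffs (\<lambda>k. mpow X k $ i $ j / fact k) k = (\<Sum>l\<in>UNIV. X $ i $ l * (mpow X k $ l $ j / fact k))"
    for k
  proof -
    have "diffs (\<lambda>k. mpow X k $ i $ j / fact k) k = mpow X (Suc k) $ i $ j / fact k"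
      by (simp add: diffs_def del: funpow.simps of_nat_Suc)
    then show ?thesis
      by (simp add: matrix_matrix_mult_def sum_divide_distrib)
  qed
  have "((\<lambda>t. \<Sum>k. mpow X k $ i $ j / fact k * t ^ k) has_field_derivative
      (\<Sum>k. diffs (\<lambda>k. mpow X k $ i $ j / fact k) k * t ^ k)) (at t)"
    by (rule termdiffs_strong_converges_everywhere) (rule summable_mexp_entry)
  also have "(\<Sum>k. diffs (\<lambda>k. mpow X k $ i $ j / fact k) k * t ^ k)
      = (\<Sum>k. \<Sum>l\<in>UNIV. X $ i $ l * (mpow X k $ l $ j / fact k * t ^ k))"
    by (simp only: *) (simp add: sum_distrib_right mult.assoc)
  also have "\<dots> = (\<Sum>l\<in>UNIV. \<Sum>k. X $ i $ l * (mpow X k $ l $ j / fact k * t ^ k))"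
    by (intro suminf_sum summable_mult summable_mexp_entry)
  also have "\<dots> = (X ** mexp (t *\<^sub>R X)) $ i $ j"
    by (simp only: matrix_matrix_mult_def vec_lambda_beta mexp_entry suminf_mult[OF summable_mexp_entry])
  finally show ?thesis
    by (simp add: mexp_entry)
qed

lemma mexp_vec_deriv:
  "((\<lambda>t. (mexp (t *\<^sub>R X) *v x) $ i) has_field_derivative (X *v (mexp (t *\<^sub>R X) *v x)) $ i) (at t)"
proof -
  have "((\<lambda>t. \<Sum>j\<in>UNIV. mexp (t *\<^sub>R X) $ i $ j * x $ j) has_field_derivative
      (\<Sum>j\<in>UNIV. (X ** mexp (t *\<^sub>R X)) $ i $ j * x $ j)) (at t)"
    by (intro DERIV_sum DERIV_cmult_right mexp_entry_deriv)
  then show ?thesis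
    by (simp add: matrix_vector_mul_assoc) (simp add: matrix_vector_mult_def)
qed

lemma continuous_on_mexp_path: "continuous_on S (\<lambda>t. mexp (t *\<^sub>R X))"
proof -
  have "continuous_on S (\<lambda>t. \<chi> i. \<chi> j. mexp (t *\<^sub>R X) $ i $ j)"
    by (intro continuous_on_vec_lambda)
      (rule DERIV_continuous_on [OF has_field_derivative_at_within [OF mexp_entry_deriv]])
  then show ?thesis
    by (simp add: vec_lambda_eta)
qed

text \<open>
  If \<open>l \<circ> X = c l\<close>, then \<open>l \<circ> X\<^sup>k = c\<^sup>k l\<close> and the exponential series sums to \<open>e\<^sup>c l\<close>. The set \<open>V\<close> allows
  functionals that are eigenvectors only on an invariant set of vectors. All the coordinates that the
  groups below preserve or rescale are controlled in this way, without computing an exponential.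
\<close>

lemma mexp_eigenfunctional:
  fixes l :: "'m::finite vec2n \<Rightarrow> real"
  assumes "linear l" "x \<in> V"
    and inv: "\<And>y. y \<in> V \<Longrightarrow> X *v y \<in> V" and eig: "\<And>y. y \<in> V \<Longrightarrow> l (X *v y) = c * l y"
  shows "l (mexp X *v x) = exp c * l x"
proof -
  have V: "(((*v) X) ^^ k) x \<in> V" for k
    by (induction k) (simp_all add: assms)
  have "l ((((*v) X) ^^ k) x) = c ^ k * l x" for k
    by (induction k) (simp_all add: eig V)
  then have pow: "l (mpow X k *v x) = c ^ k * l x" for k
    by (simp only: mpow_mult_vec)
  have "linear (\<lambda>M. l (M *v x))"
    using \<open>linear l\<close>
    by (simp add: linear_iff matrix_vector_mult_add_rdistrib flip: scaleR_matrix_vector_assoc)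
  from mexp_linear_sums[OF this, of X]
  have "(\<lambda>k. c ^ k / fact k * l x) sums l (mexp X *v x)"
    by (simp add: pow)
  moreover have "(\<lambda>k. c ^ k / fact k * l x) sums (exp c * l x)"
    using sums_mult2[OF exp_converges[of c], of "l x"] by (simp add: divide_inverse mult.commute)
  ultimately show ?thesis
    by (rule sums_unique2)
qed

lemma mexp_nilpotent:
  assumes "X *v (X *v (X *v x)) = 0"
  shows "mexp X *v x = x + X *v x + (1 / 2) *\<^sub>R (X *v (X *v x))"
proof -
  have "(((*v) X) ^^ k) x = 0" if "k \<ge> 3" for k
    using that by (induction k rule: dec_induct)
      (simp_all add: assms numeral_3_eq_3)
  then have zero: "mpow X k *v x = 0" if "k \<ge> 3" for k
    using that by (simp only: mpow_mult_vec)
  have "linear (\<lambda>M. M *v x)"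
    by (simp add: linear_iff matrix_vector_mult_add_rdistrib flip: scaleR_matrix_vector_assoc)
  from mexp_linear_sums[OF this, of X]
  have "(\<lambda>k. (1 / fact k) *\<^sub>R (mpow X k *v x)) sums (mexp X *v x)" .
  moreover have "(\<lambda>k. (1 / fact k) *\<^sub>R (mpow X k *v x)) sums
      (\<Sum>k<3. (1 / fact k) *\<^sub>R (mpow X k *v x))"
    by (rule sums_finite) (auto simp: zero)
  ultimately have "mexp X *v x = (\<Sum>k<3. (1 / fact k) *\<^sub>R (mpow X k *v x))"
    by (rule sums_unique2)
  then show ?thesis
    by (simp add: numeral_3_eq_3 mpow_mult_vec)
qed

text \<open>
  The derivative of \<open>t \<mapsto> sprod (exp (t X) x) (exp (t X) y)\<close> vanishes by skewness of \<open>X\<close>.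
\<close>

lemma sprod_mexp:
  assumes "X \<in> so2n"
  shows "sprod (mexp X *v x) (mexp X *v y) = sprod x y"
proof -
  define f where "f t = sprod (mexp (t *\<^sub>R X) *v x) (mexp (t *\<^sub>R X) *v y)" for t
  have "(f has_field_derivative 0) (at t)" for t
  proof -
    let ?x = "mexp (t *\<^sub>R X) *v x" and ?y = "mexp (t *\<^sub>R X) *v y"
    have "(f has_field_derivative (sprod (X *v ?x) ?y + sprod ?x (X *v ?y))) (at t)"
      unfolding f_def sprod_def
      by (rule derivative_eq_intros mexp_vec_deriv refl)+
        (simp add: sum.distrib algebra_simps)
    then show ?thesis
      using assms by (simp add: so2n_def)
  qed
  then have "f 1 = f 0"
    by (intro DERIV_isconst_all) simp
  then show ?thesis
    by (simp add: f_def mexp_0)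
qed

section \<open>The group of isometries\<close>

lemma sum_idx: "(\<Sum>i\<in>UNIV. f i) = f I1 + f I2 + f I3 + f I4 + (\<Sum>j\<in>(UNIV :: 'm::finite set). f (Rest j))"
  for f :: "'m::finite idx \<Rightarrow> 'b::comm_monoid_add"
proof -
  have "(\<Sum>i\<in>UNIV. f i) = (\<Sum>i\<in>{I1, I2, I3, I4}. f i) + (\<Sum>i\<in>range Rest. f i)"
    unfolding UNIV_idx by (rule sum.union_disjoint) auto
  also have "(\<Sum>i\<in>range Rest. f i) = (\<Sum>j\<in>UNIV. f (Rest j))"
    by (rule sum.reindex_cong[of Rest]) (auto simp: inj_def)
  finally show ?thesis
    by (simp add: add.assoc)
qed

definition sprod_matrix :: "'m::finite mat2n" where
  "sprod_matrix = (\<chi> i j. if i = j then (if i \<in> {I1, I2} then - 1 else 1) else 0)"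

lemma sprod_eq_inner: "sprod x y = x \<bullet> (sprod_matrix *v y)"
  by (simp add: sprod_def inner_vec_def sum_idx sprod_matrix_def matrix_vector_mult_def
      if_distrib[of "\<lambda>c. c * _"] sum.delta' cong: if_cong)

text \<open>
  With \<open>J\<close> the matrix of the scalar product, an isometry satisfies \<open>g\<^sup>T J g = J\<close>; take determinants.
\<close>

lemma det_of_sprod_isometry:
  fixes g :: "'m::finite mat2n"
  assumes "\<And>x y. sprod (g *v x) (g *v y) = sprod x y"
  shows "det g = 1 \<or> det g = - 1"
proof -
  let ?J = "sprod_matrix :: 'm mat2n"
  have "x \<bullet> ((transpose g ** ?J ** g) *v y) = x \<bullet> (?J *v y)" for x y
    using assms[of x y]
    by (simp add: sprod_eq_inner dot_lmul_matrix flip: matrix_vector_mul_assoc)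
       (metis dot_lmul_matrix vector_transpose_matrix transpose_transpose)
  then have "(transpose g ** ?J ** g) *v y = ?J *v y" for y
    by (metis vector_eq_ldot)
  then have "transpose g ** ?J ** g = ?J"
    by (simp add: matrix_eq)
  then have "det g * det ?J * det g = det ?J"
    by (metis det_mul det_transpose)
  moreover have "det ?J = (\<Prod>i\<in>UNIV. ?J $ i $ i)"
    by (rule det_diagonal) (simp add: sprod_matrix_def)
  then have "det ?J \<noteq> 0"
    by (simp add: sprod_matrix_def)
  ultimately have "det g * det g = 1"
    by (simp add: mult.commute mult.assoc)
  then show ?thesis
    by (simp add: square_eq_1_iff)
qed

lemma so2n_scaleR:
  fixes X :: "'m::finite mat2n"
  shows "X \<in> so2n \<Longrightarrow> t *\<^sub>R X \<in> so2n"
proof -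
  have "sprod (t *\<^sub>R x) y = t * sprod x y" "sprod x (t *\<^sub>R y) = t * sprod x y" for x y :: "'m vec2n"
    by (simp_all add: sprod_def algebra_simps sum_distrib_left)
  then show "X \<in> so2n \<Longrightarrow> t *\<^sub>R X \<in> so2n"
    by (simp add: so2n_def flip: scaleR_matrix_vector_assoc distrib_left)
qed

lemma mat_1_in_SO2n: "mat 1 \<in> SO2n"
  by (simp add: SO2n_def)

lemma SO2n_mult: "g \<in> SO2n \<Longrightarrow> h \<in> SO2n \<Longrightarrow> g ** h \<in> SO2n"
  by (simp add: SO2n_def det_mul flip: matrix_vector_mul_assoc)

lemma SO2n_inverse:
  assumes "g \<in> SO2n"
  obtains h where "h \<in> SO2n" "h ** g = mat 1" "g ** h = mat 1"
proof -
  from assms have "invertible g"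
    by (simp add: SO2n_def invertible_det_nz)
  then obtain h where h: "g ** h = mat 1" "h ** g = mat 1"
    by (auto simp: invertible_def)
  from h(1) have "det g * det h = 1"
    by (metis det_I det_mul)
  then have "det h = 1"
    using assms by (simp add: SO2n_def)
  moreover have "sprod (h *v x) (h *v y) = sprod x y" for x y
  proof -
    have "sprod (h *v x) (h *v y) = sprod (g *v (h *v x)) (g *v (h *v y))"
      using assms by (simp add: SO2n_def)
    then show ?thesis
      by (simp add: matrix_vector_mul_assoc h(1))
  qed
  ultimately show ?thesis
    by (intro that [of h]) (simp_all add: SO2n_def h)
qed

lemma SO0_group_simps [simp]:
  "g \<otimes>\<^bsub>SO0_group\<^esub> h = g ** h" "\<one>\<^bsub>SO0_group\<^esub> = mat 1"
  by (simp_all add: SO0_group_def)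

lemma SO0_subset_SO2n: "g \<in> carrier SO0_group \<Longrightarrow> g \<in> SO2n"
  using connected_component_subset by (auto simp: SO0_group_def)

text \<open>
  Closure of the identity component under the group operations is shown by translating it: the
  translate is again connected and meets the component.
\<close>

lemma SO0_I:
  assumes "connected C" "C \<subseteq> SO2n" "h \<in> C" "g \<in> C" "h \<in> carrier SO0_group"
  shows "g \<in> carrier SO0_group"
proof -
  have "connected_component SO2n (mat 1) h"
    using assms by (simp add: SO0_group_def)
  moreover have "connected_component SO2n h g"
    using assms by (auto simp: connected_component_def)
  ultimately have "connected_component SO2n (mat 1) g"
    by (rule connected_component_trans)
  then show ?thesis
    by (simp add: SO0_group_def)
qed

lemma mat_1_in_SO0: "mat 1 \<in> carrier SO0_group"
  by (simp add: SO0_group_def mat_1_in_SO2n)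

lemma connected_SO0: "connected (carrier SO0_group)"
  by (simp add: SO0_group_def)

lemma connected_left_translate:
  fixes g :: "'m::finite mat2n"
  assumes "connected C"
  shows "connected ((\<lambda>h. g ** h) ` C)"
proof -
  have "linear (\<lambda>h. g ** h)"
    by (simp add: linear_iff matrix_add_ldistrib matrix_scalar_ac scalar_matrix_assoc)
  then show ?thesis
    using assms by (intro connected_continuous_image linear_continuous_on)
      (simp_all add: linear_conv_bounded_linear)
qed

lemma group_SO0: "group (SO0_group :: 'm::finite mat2n monoid)"
proof (rule groupI)
  fix g h :: "'m mat2n"
  assume gh: "g \<in> carrier SO0_group" "h \<in> carrier SO0_group"
  show "g \<otimes>\<^bsub>SO0_group\<^esub> h \<in> carrier SO0_group"
  proof (rule SO0_I)
    show "connected ((\<lambda>h. g ** h) ` carrier SO0_group)"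
      by (rule connected_left_translate [OF connected_SO0])
    show "(\<lambda>h. g ** h) ` carrier SO0_group \<subseteq> SO2n"
      using gh by (auto intro: SO2n_mult SO0_subset_SO2n)
    show "g \<in> (\<lambda>h. g ** h) ` carrier SO0_group"
      using mat_1_in_SO0 by (force simp: image_iff)
  qed (use gh in auto)
next
  fix g :: "'m mat2n"
  assume g: "g \<in> carrier SO0_group"
  then obtain h where h: "h \<in> SO2n" "h ** g = mat 1"
    using SO2n_inverse SO0_subset_SO2n by metis
  have "h \<in> carrier SO0_group"
  proof (rule SO0_I)
    show "connected ((\<lambda>k. h ** k) ` carrier SO0_group)"
      by (rule connected_left_translate [OF connected_SO0])
    show "(\<lambda>k. h ** k) ` carrier SO0_group \<subseteq> SO2n"
      using h by (auto intro: SO2n_mult SO0_subset_SO2n)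
    show "mat 1 \<in> (\<lambda>k. h ** k) ` carrier SO0_group"
      using g h by (force simp: image_iff)
    show "h \<in> (\<lambda>k. h ** k) ` carrier SO0_group"
      using mat_1_in_SO0 by (force simp: image_iff)
  qed (rule mat_1_in_SO0)
  then show "\<exists>h\<in>carrier SO0_group. h \<otimes>\<^bsub>SO0_group\<^esub> g = \<one>\<^bsub>SO0_group\<^esub>"
    using h by auto
qed (simp_all add: mat_1_in_SO0 matrix_mul_assoc)

text \<open>
  The determinant along \<open>t \<mapsto> exp (t X)\<close> is continuous, takes only the values \<open>\<plusminus>1\<close>, and is \<open>1\<close> at
  \<open>t = 0\<close>. Hence this curve stays in \<open>SO2n\<close> and joins \<open>exp X\<close> to the identity.
\<close>

lemma mexp_in_SO0:
  fixes X :: "'m::finite mat2n"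
  assumes "X \<in> so2n"
  shows "mexp X \<in> carrier SO0_group"
proof -
  let ?M = "\<lambda>t. mexp (t *\<^sub>R X)"
  have iso: "sprod (?M t *v x) (?M t *v y) = sprod x y" for t x y
    by (intro sprod_mexp so2n_scaleR assms)
  have det_pm: "det (?M t) = 1 \<or> det (?M t) = - 1" for t
    by (rule det_of_sprod_isometry) (rule iso)
  have cont: "continuous_on UNIV (\<lambda>t. det (?M t))"
    unfolding det_def
    by (intro continuous_intros continuous_on_mexp_path)
  have "det (?M t) = 1" for t
  proof (rule ccontr)
    assume "det (?M t) \<noteq> 1"
    with det_pm have m: "- 1 \<in> range (\<lambda>t. det (?M t))"
      by (metis rangeI)
    have p: "1 \<in> range (\<lambda>t. det (?M t))"
      by (rule range_eqI [of _ _ 0]) (simp add: mexp_0)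
    have "connected (range (\<lambda>t. det (?M t)))"
      by (rule connected_continuous_image [OF cont]) simp
    then have "0 \<in> range (\<lambda>t. det (?M t))"
      by (rule connectedD_interval [OF _ m p]) simp_all
    then obtain s where "det (?M s) = 0"
      by (metis (no_types, lifting) imageE)
    with det_pm [of s] show False
      by simp
  qed
  then have SO: "?M t \<in> SO2n" for t
    using iso by (simp add: SO2n_def)
  show ?thesis
  proof (rule SO0_I)
    show "connected (range ?M)"
      by (intro connected_continuous_image continuous_on_mexp_path) simp
    show "mat 1 \<in> range ?M"
      by (rule range_eqI [of _ _ 0]) (simp add: mexp_0)
    show "mexp X \<in> range ?M"
      by (rule range_eqI [of _ _ 1]) simp
  qed (use SO mat_1_in_SO0 in auto)
qed

section \<open>Actions of connected Lie subgroups on anti-de Sitter space\<close>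

lemma connected_Lie_subgroup_is_subgroup:
  "\<hh> \<subseteq> so2n \<Longrightarrow> subgroup (connected_Lie_subgroup \<hh>) SO0_group"
  unfolding connected_Lie_subgroup_def
  by (rule group.generate_is_subgroup [OF group_SO0]) (auto intro: mexp_in_SO0)

lemma mexp_in_connected_Lie_subgroup: "X \<in> \<hh> \<Longrightarrow> mexp X \<in> connected_Lie_subgroup \<hh>"
  unfolding connected_Lie_subgroup_def by (intro generate.incl imageI)

lemma connected_Lie_subgroup_mono:
  "\<hh> \<subseteq> \<kk> \<Longrightarrow> connected_Lie_subgroup \<hh> \<subseteq> connected_Lie_subgroup \<kk>"
  unfolding connected_Lie_subgroup_def by (intro group.mono_generate [OF group_SO0] image_mono)

lemma SO0_sprod: "g \<in> carrier SO0_group \<Longrightarrow> sprod (g *v x) (g *v y) = sprod x y"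
  using SO0_subset_SO2n by (auto simp: SO2n_def)

lemma SO0_AdS: "g \<in> carrier SO0_group \<Longrightarrow> g *v x \<in> AdS \<longleftrightarrow> x \<in> AdS"
  by (simp add: AdS_def SO0_sprod)

lemma SO0_inv_vec:
  assumes "g \<in> carrier SO0_group"
  shows "(inv\<^bsub>SO0_group\<^esub> g) *v (g *v x) = x" "g *v ((inv\<^bsub>SO0_group\<^esub> g) *v x) = x"
  using group.l_inv [OF group_SO0 assms] group.r_inv [OF group_SO0 assms]
  by (simp_all add: matrix_vector_mul_assoc)

lemma SO0_bij_betw_AdS:
  fixes g :: "'m::finite mat2n"
  assumes "g \<in> carrier SO0_group"
  shows "bij_betw (AdS_act g) AdS AdS"
proof (rule bij_betw_byWitness [where f' = "\<lambda>x. (inv\<^bsub>SO0_group\<^esub> g) *v x"])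
  have "inv\<^bsub>SO0_group\<^esub> g \<in> carrier SO0_group"
    by (rule group.inv_closed [OF group_SO0 assms])
  then show "(\<lambda>x. (inv\<^bsub>SO0_group\<^esub> g) *v x) ` AdS \<subseteq> AdS"
    and "AdS_act g ` AdS \<subseteq> AdS"
    and "\<forall>x\<in>AdS. (inv\<^bsub>SO0_group\<^esub> g) *v (AdS_act g x) = x"
    and "\<forall>x\<in>AdS. AdS_act g ((inv\<^bsub>SO0_group\<^esub> g) *v x) = x"
    using assms by (auto simp: AdS_act_def SO0_AdS SO0_inv_vec)
qed

lemma AdS_isometry_act:
  assumes "g \<in> carrier SO0_group"
  shows "AdS_isometry (AdS_act g)"
  unfolding AdS_isometry_def
proof (intro conjI exI [of _ "\<lambda>p. g"] ballI)
  show "bij_betw (AdS_act g) AdS AdS"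
    by (rule SO0_bij_betw_AdS [OF assms])
  fix p :: "'a vec2n" assume p: "p \<in> AdS"
  show "(AdS_act g has_derivative (\<lambda>v. g *v v)) (at p within AdS)"
  proof (rule has_derivative_transform [OF p])
    show "((\<lambda>v. g *v v) has_derivative (\<lambda>v. g *v v)) (at p within AdS)"
      by (intro bounded_linear_imp_has_derivative) simp
  qed (simp add: AdS_act_def)
  show "sprod (g *v u) (g *v v) = sprod u v" for u v
    by (rule SO0_sprod [OF assms])
qed simp

lemma group_action_AdS:
  assumes "subgroup G SO0_group"
  shows "group_action (subgrp G) AdS AdS_act"
proof -
  have car: "g \<in> carrier SO0_group" if "g \<in> G" for g
    using assms that by (rule subgroup.mem_carrier)
  have Bij: "AdS_act g \<in> Bij AdS" if "g \<in> G" for g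
    using SO0_bij_betw_AdS [OF car [OF that]] by (simp add: Bij_def AdS_act_def)
  have "group (subgrp G)"
    by (rule subgroup.subgroup_is_group [OF assms group_SO0])
  moreover have "AdS_act (g ** h) = compose AdS (AdS_act g) (AdS_act h)" if "g \<in> G" "h \<in> G" for g h
    using SO0_AdS [OF car [OF that(2)]]
    by (auto simp: compose_def AdS_act_def fun_eq_iff matrix_vector_mul_assoc)
  ultimately have "group_hom (subgrp G) (BijGroup AdS) AdS_act"
    by (intro group_hom.intro group_hom_axioms.intro group_BijGroup homI)
      (simp_all add: BijGroup_def Bij)
  then show ?thesis
    by (rule group_action.intro)
qed

lemma acts_isometrically_subgroup: "subgroup G SO0_group \<Longrightarrow> acts_isometrically G"
  unfolding acts_isometrically_def
  using group_action_AdS AdS_isometry_act subgroup.mem_carrier by metis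

lemma orbit_AdS: "x \<in> AdS \<Longrightarrow> orbit (subgrp G) AdS_act x = {g *v x | g. g \<in> G}"
  by (auto simp: orbit_def AdS_act_def)

text \<open>
  To bound the orbits of a connected Lie subgroup from above it suffices to look at exponentials.
\<close>

lemma invariant_of_generators:
  fixes g :: "'m::finite mat2n"
  assumes "g \<in> connected_Lie_subgroup \<hh>" "\<hh> \<subseteq> so2n" "x \<in> AdS"
    and gen: "\<And>X x. X \<in> \<hh> \<Longrightarrow> x \<in> AdS \<Longrightarrow> f (mexp X *v x) = f x"
  shows "f (g *v x) = f x"
  using assms(1,3) unfolding connected_Lie_subgroup_def
proof (induction arbitrary: x rule: generate.induct)
  case (inv h)
  then obtain X where X: "X \<in> \<hh>" "h = mexp X"
    by auto
  then have h: "h \<in> carrier SO0_group"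
    using assms(2) mexp_in_SO0 by blast
  then have "inv\<^bsub>SO0_group\<^esub> h \<in> carrier SO0_group"
    by (rule group.inv_closed [OF group_SO0])
  then have "(inv\<^bsub>SO0_group\<^esub> h) *v x \<in> AdS"
    using inv by (simp add: SO0_AdS)
  from gen[OF X(1) this] show ?case
    using SO0_inv_vec(2)[OF h, of x] X(2) by simp
next
  case (eng h1 h2)
  have "h2 \<in> carrier SO0_group"
    using group.generate_in_carrier [OF group_SO0 _ eng.hyps(2)] assms(2) mexp_in_SO0 by blast
  then have "h2 *v x \<in> AdS"
    using eng.prems by (simp add: SO0_AdS)
  with eng show ?case
    by (simp flip: matrix_vector_mul_assoc)
qed (auto intro: gen)

text \<open>
  An orbit that is relatively open in \<open>AdS\<close> has the same tangent space as \<open>AdS\<close>: a curve in \<open>AdS\<close> through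
  one of its points remains in the orbit for a short time.
\<close>

lemma cohomogeneity_zero:
  assumes "p \<in> AdS" "open U" "p \<in> U"
    and orbit: "orbit (subgrp G) AdS_act p = U \<inter> AdS"
  shows "cohomogeneity G = 0"
proof -
  have "tangent_space AdS p \<subseteq> tangent_space (U \<inter> AdS) p"
  proof
    fix v assume "v \<in> tangent_space AdS p"
    then obtain \<gamma> \<epsilon> where \<gamma>: "0 < \<epsilon>" "\<gamma> C1_differentiable_on {-\<epsilon><..<\<epsilon>}" "\<gamma> ` {-\<epsilon><..<\<epsilon>} \<subseteq> AdS"
      "\<gamma> 0 = p" "(\<gamma> has_vector_derivative v) (at (0::real))"
      by (auto simp: tangent_space_def)
    have "isCont \<gamma> 0"
      using \<gamma>(5) has_vector_derivative_continuous by blast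
    moreover obtain e where e: "e > 0" "ball p e \<subseteq> U"
      using \<open>open U\<close> \<open>p \<in> U\<close> by (meson openE)
    ultimately obtain \<delta> where "\<delta> > 0" and *: "\<And>t. dist t 0 < \<delta> \<Longrightarrow> dist (\<gamma> t) (\<gamma> 0) < e"
      unfolding continuous_at_eps_delta by (metis (no_types))
    then have \<delta>: "\<delta> > 0" "\<And>t. \<bar>t\<bar> < \<delta> \<Longrightarrow> \<gamma> t \<in> U"
      using * e(2) \<gamma>(4) by (auto simp: dist_commute subset_iff)
    define \<eta> where "\<eta> = min \<epsilon> \<delta>"
    have sub: "{-\<eta><..<\<eta>} \<subseteq> {-\<epsilon><..<\<epsilon>}"
      by (auto simp: \<eta>_def)
    have "\<gamma> ` {-\<eta><..<\<eta>} \<subseteq> U \<inter> AdS"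
      using \<gamma>(3) \<delta>(2) by (auto simp: \<eta>_def image_subset_iff abs_less_iff)
    moreover have "\<gamma> C1_differentiable_on {-\<eta><..<\<eta>}"
      using \<gamma>(2) sub by (rule C1_differentiable_on_subset)
    moreover have "0 < \<eta>"
      using \<gamma>(1) \<delta>(1) by (simp add: \<eta>_def)
    ultimately show "v \<in> tangent_space (U \<inter> AdS) p"
      using \<gamma>(4,5) unfolding tangent_space_def by blast
  qed
  moreover have "tangent_space (U \<inter> AdS) p \<subseteq> tangent_space AdS p"
    unfolding tangent_space_def by blast
  ultimately have "orbit_codim G p = 0"
    by (simp add: orbit_codim_def orbit)
  then show ?thesis
    unfolding cohomogeneity_def
    using cINF_lower [of "orbit_codim G" AdS p] \<open>p \<in> AdS\<close> by simp
qed

section \<open>Light-cone coordinates\<close>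

text \<open>
  These coordinates diagonalise \<open>\<aa>\<close>: \<open>Hmat a b\<close> has the weights \<open>-a, a, -b, b, 0\<close> on
  \<open>u1, w1, u2, w2, z_part\<close>. The scalar product pairs \<open>u1\<close> with \<open>w1\<close> and \<open>u2\<close> with \<open>w2\<close>.
\<close>

definition u1 :: "'m::finite vec2n \<Rightarrow> real" where "u1 x = x $ I1 - x $ I3"
definition w1 :: "'m::finite vec2n \<Rightarrow> real" where "w1 x = x $ I1 + x $ I3"
definition u2 :: "'m::finite vec2n \<Rightarrow> real" where "u2 x = x $ I2 - x $ I4"
definition w2 :: "'m::finite vec2n \<Rightarrow> real" where "w2 x = x $ I2 + x $ I4"
definition z_part :: "'m::finite vec2n \<Rightarrow> real ^ 'm" where "z_part x = (\<chi> j. x $ Rest j)"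

lemmas lightcone_defs = u1_def w1_def u2_def w2_def z_part_def

definition of_lightcone :: "real \<Rightarrow> real \<Rightarrow> real \<Rightarrow> real \<Rightarrow> real ^ 'm \<Rightarrow> 'm::finite vec2n" where
  "of_lightcone a b c d v = (\<chi> i. case i of I1 \<Rightarrow> (a + b) / 2 | I2 \<Rightarrow> (c + d) / 2
      | I3 \<Rightarrow> (b - a) / 2 | I4 \<Rightarrow> (d - c) / 2 | Rest j \<Rightarrow> v $ j)"

lemma lightcone_coords [simp]:
  "u1 (of_lightcone a b c d v) = a" "w1 (of_lightcone a b c d v) = b"
  "u2 (of_lightcone a b c d v) = c" "w2 (of_lightcone a b c d v) = d"
  "z_part (of_lightcone a b c d v) = v"
  by (simp_all add: lightcone_defs of_lightcone_def field_simps vec_eq_iff)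

lemma lightcone_linear [simp]:
  "u1 (x + y) = u1 x + u1 y" "u1 (t *\<^sub>R x) = t * u1 x" "u1 (x - y) = u1 x - u1 y" "u1 0 = 0"
  "w1 (x + y) = w1 x + w1 y" "w1 (t *\<^sub>R x) = t * w1 x" "w1 (x - y) = w1 x - w1 y" "w1 0 = 0"
  "u2 (x + y) = u2 x + u2 y" "u2 (t *\<^sub>R x) = t * u2 x" "u2 (x - y) = u2 x - u2 y" "u2 0 = 0"
  "w2 (x + y) = w2 x + w2 y" "w2 (t *\<^sub>R x) = t * w2 x" "w2 (x - y) = w2 x - w2 y" "w2 0 = 0"
  "z_part (x + y) = z_part x + z_part y" "z_part (t *\<^sub>R x) = t *\<^sub>R z_part x"
  "z_part (x - y) = z_part x - z_part y" "z_part 0 = 0"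
  by (simp_all add: lightcone_defs algebra_simps vec_eq_iff)

lemma lightcone_uminus [simp]:
  "u1 (- x) = - u1 x" "w1 (- x) = - w1 x" "u2 (- x) = - u2 x" "w2 (- x) = - w2 x" "z_part (- x) = - z_part x"
  by (simp_all add: lightcone_defs vec_eq_iff)

lemma linear_u: "linear u1" "linear u2"
  by (simp_all add: linear_iff)

lemma lightcone_eq_iff:
  "x = y \<longleftrightarrow> u1 x = u1 y \<and> w1 x = w1 y \<and> u2 x = u2 y \<and> w2 x = w2 y \<and> z_part x = z_part y"
proof (intro iffI)
  assume eq: "u1 x = u1 y \<and> w1 x = w1 y \<and> u2 x = u2 y \<and> w2 x = w2 y \<and> z_part x = z_part y"
  have "x $ i = y $ i" for i
    using eq by (cases i) (auto simp: lightcone_defs vec_eq_iff)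
  then show "x = y"
    by (simp add: vec_eq_iff)
qed simp

lemma sprod_lightcone:
  "sprod x y = z_part x \<bullet> z_part y - (u1 x * w1 y + w1 x * u1 y + u2 x * w2 y + w2 x * u2 y) / 2"
  by (simp add: sprod_def lightcone_defs inner_vec_def field_simps)

lemma AdS_lightcone: "x \<in> AdS \<longleftrightarrow> u1 x * w1 x + u2 x * w2 x = 1 + z_part x \<bullet> z_part x"
  by (simp add: AdS_def sprod_lightcone field_simps) linarith

text \<open>
  At a common zero of \<open>u1\<close> and \<open>u2\<close> the equation of \<open>AdS\<close> would read \<open>0 = 1 + |z|\<^sup>2\<close>.
\<close>

lemma AdS_u_nonzero:
  assumes "x \<in> AdS" "u2 x = 0"
  shows "u1 x \<noteq> 0"
proof
  assume "u1 x = 0"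
  with assms have "1 + z_part x \<bullet> z_part x = 0"
    by (simp add: AdS_lightcone)
  then show False
    using inner_ge_zero [of "z_part x"] by linarith
qed

lemma Hmat_lightcone [simp]:
  "u1 (Hmat a b *v x) = - a * u1 x" "w1 (Hmat a b *v x) = a * w1 x"
  "u2 (Hmat a b *v x) = - b * u2 x" "w2 (Hmat a b *v x) = b * w2 x" "z_part (Hmat a b *v x) = 0"
  by (simp_all add: lightcone_defs matrix_vector_mult_def Hmat_def sum_idx vec_eq_iff algebra_simps)

section \<open>Root vectors and the action of the root spaces\<close>

text \<open>
  The parameters \<open>a, b, v, w\<close> are those of the matrices of \<open>\<nn>\<close>, up to a factor 2 on \<open>a\<close> and \<open>b\<close>; the
  parameter \<open>c\<close> belongs to the negative root \<open>- alpha1\<close>.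
\<close>

definition root_elt :: "real \<Rightarrow> real \<Rightarrow> real ^ 'm \<Rightarrow> real ^ 'm \<Rightarrow> real \<Rightarrow> 'm::finite mat2n" where
  "root_elt a b v w c = matrix (\<lambda>x. of_lightcone (b * u2 x) (a * u2 x + 2 * (v \<bullet> z_part x) - c * w2 x)
     (c * u1 x) (2 * (w \<bullet> z_part x) - a * u1 x - b * w1 x) (u1 x *\<^sub>R v + u2 x *\<^sub>R w))"

lemma root_elt_vec: "root_elt a b v w c *v x = of_lightcone (b * u2 x) (a * u2 x + 2 * (v \<bullet> z_part x) - c * w2 x)
     (c * u1 x) (2 * (w \<bullet> z_part x) - a * u1 x - b * w1 x) (u1 x *\<^sub>R v + u2 x *\<^sub>R w)"
proof -
  have "linear (\<lambda>x. of_lightcone (b * u2 x) (a * u2 x + 2 * (v \<bullet> z_part x) - c * w2 x)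
      (c * u1 x) (2 * (w \<bullet> z_part x) - a * u1 x - b * w1 x) (u1 x *\<^sub>R v + u2 x *\<^sub>R w))"
    by (simp add: linear_iff lightcone_eq_iff algebra_simps)
  then show ?thesis
    by (simp add: root_elt_def matrix_works)
qed

lemma root_spaceI:
  assumes "X \<in> so2n"
    and "\<And>a b x. Hmat a b *v (X *v x) - X *v (Hmat a b *v x) = \<mu> (Hmat a b) *\<^sub>R (X *v x)"
  shows "X \<in> root_space \<mu>"
proof -
  have "bracket (Hmat a b) X = \<mu> (Hmat a b) *\<^sub>R X" for a b
    using assms(2)
    by (simp add: bracket_def matrix_eq matrix_vector_mult_diff_rdistrib
        flip: matrix_vector_mul_assoc scaleR_matrix_vector_assoc)
  then show ?thesis
    using assms(1) by (auto simp: root_space_def lie_a_def)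
qed

lemma root_elt_so2n: "root_elt a b v w c \<in> so2n"
  by (simp add: so2n_def root_elt_vec sprod_lightcone inner_add_right inner_commute field_simps)

lemma root_elt_in_root_space:
  "root_elt 0 b 0 0 0 \<in> root_space alpha1"
  "root_elt 0 0 v 0 0 \<in> root_space alpha2"
  "root_elt 0 0 0 w 0 \<in> root_space (\<lambda>H. alpha1 H + alpha2 H)"
  "root_elt a 0 0 0 0 \<in> root_space (\<lambda>H. alpha1 H + 2 * alpha2 H)"
  "root_elt 0 0 0 0 c \<in> root_space (\<lambda>H. - alpha1 H)"
  by (auto intro!: root_spaceI root_elt_so2n simp: root_elt_vec lightcone_eq_iff alpha_Hmat algebra_simps)

lemma so2n_add: "X \<in> so2n \<Longrightarrow> Y \<in> so2n \<Longrightarrow> X + Y \<in> so2n"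
  by (simp add: so2n_def sprod_lightcone matrix_vector_mult_add_rdistrib inner_add_left inner_add_right field_simps)

lemma zero_in_root_space: "0 \<in> root_space \<mu>"
  by (simp add: root_space_def so2n_def sprod_def bracket_def)

lemma root_space_so2n: "root_space \<mu> \<subseteq> so2n"
  by (auto simp: root_space_def)

lemma lie_a_so2n: "lie_a \<subseteq> so2n"
  by (auto simp: lie_a_def so2n_def sprod_lightcone field_simps)

lemma set_plus_so2n: "A \<subseteq> so2n \<Longrightarrow> B \<subseteq> so2n \<Longrightarrow> A + B \<subseteq> so2n"
  by (auto elim!: set_plus_elim intro: so2n_add)

lemma zero_in_set_plus:
  "0 \<in> A \<Longrightarrow> 0 \<in> B \<Longrightarrow> 0 \<in> A + B" for A B :: "'a::comm_monoid_add set"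
  using set_plus_intro [of 0 A 0 B] by simp

lemma zero_in_lie:
  "(0 :: 'm::finite mat2n) \<in> lie_k0" "(0 :: 'm mat2n) \<in> lie_a" "(0 :: 'm mat2n) \<in> lie_n" "(0 :: 'm mat2n) \<in> lie_q0"
proof -
  show k0: "(0 :: 'm mat2n) \<in> lie_k0"
    using zero_in_root_space by (auto simp: lie_k0_def lie_k_def root_space_def transpose_def vec_eq_iff)
  have "(0 :: 'm mat2n) = Hmat 0 0"
    by (simp add: Hmat_def vec_eq_iff)
  then show a: "(0 :: 'm mat2n) \<in> lie_a"
    unfolding lie_a_def by blast
  show n: "(0 :: 'm mat2n) \<in> lie_n"
    unfolding lie_n_def by (intro zero_in_set_plus zero_in_root_space)
  show "(0 :: 'm mat2n) \<in> lie_q0"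
    unfolding lie_q0_def by (intro zero_in_set_plus k0 a n)
qed

lemma lie_subset_so2n:
  "lie_n \<subseteq> so2n" "lie_q0 \<subseteq> so2n" "lie_q1 \<subseteq> so2n" "lie_q2 \<subseteq> so2n"
  unfolding lie_q2_def lie_q1_def lie_q0_def lie_n_def lie_k0_def
  by (intro set_plus_so2n root_space_so2n lie_a_so2n le_infI1)+

lemma subset_set_plus:
  fixes A B :: "'a::comm_monoid_add set"
  shows "0 \<in> B \<Longrightarrow> A \<subseteq> A + B" "0 \<in> A \<Longrightarrow> B \<subseteq> A + B"
  by (force intro: set_plus_intro [of _ A 0 B, simplified])
    (force intro: set_plus_intro [of 0 A _ B, simplified])

lemma lie_inclusions:
  shows "(lie_a :: 'm::finite mat2n set) \<subseteq> lie_q0" "(lie_n :: 'm mat2n set) \<subseteq> lie_q0"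
    "(lie_q0 :: 'm mat2n set) \<subseteq> lie_q1" "(lie_q0 :: 'm mat2n set) \<subseteq> lie_q2"
    "root_space (\<lambda>H :: 'm mat2n. - alpha1 H) \<subseteq> lie_q2"
proof -
  note zero = zero_in_root_space zero_in_lie
  show "(lie_a :: 'm mat2n set) \<subseteq> lie_q0"
    unfolding lie_q0_def by (rule order_trans [OF subset_set_plus(2) subset_set_plus(1)]) (rule zero)+
  show "(lie_n :: 'm mat2n set) \<subseteq> lie_q0"
    unfolding lie_q0_def by (rule subset_set_plus(2)) (rule zero_in_set_plus zero)+
  show "(lie_q0 :: 'm mat2n set) \<subseteq> lie_q1" "(lie_q0 :: 'm mat2n set) \<subseteq> lie_q2"
    "root_space (\<lambda>H :: 'm mat2n. - alpha1 H) \<subseteq> lie_q2"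
    unfolding lie_q1_def lie_q2_def by (intro subset_set_plus zero)+
qed

lemma root_spaces_subset_lie_n:
  "root_space alpha1 \<subseteq> lie_n" "root_space alpha2 \<subseteq> lie_n"
  "root_space (\<lambda>H. alpha1 H + alpha2 H) \<subseteq> lie_n" "root_space (\<lambda>H. alpha1 H + 2 * alpha2 H) \<subseteq> lie_n"
  unfolding lie_n_def
  by (rule order_trans [OF subset_set_plus(1) order_trans [OF subset_set_plus(1) subset_set_plus(1)]]
        order_trans [OF subset_set_plus(2) order_trans [OF subset_set_plus(1) subset_set_plus(1)]]
        order_trans [OF subset_set_plus(2) subset_set_plus(1)] subset_set_plus(2);
      intro zero_in_set_plus zero_in_root_space)+

text \<open>
  A functional that is an eigenvector of \<open>\<phi> \<mapsto> \<phi> \<circ> H\<close> vanishes on the eigenvectors of \<open>H\<close> for other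
  eigenvalues. The element \<open>H = Hmat 1 3\<close> separates the weights: they take the distinct values \<open>\<plusminus>1, \<plusminus>3, 0\<close>.
  The eigenvalue \<open>-3\<close> is that of \<open>u2\<close>.
\<close>

lemma Hmat_eigenfunctional:
  fixes \<phi> :: "'m::finite vec2n \<Rightarrow> real"
  assumes "linear \<phi>" and eig: "\<And>y. \<phi> (Hmat 1 3 *v y) = \<kappa> * \<phi> y" and "\<kappa> \<notin> {0, 1, - 1, 3}"
  shows "\<exists>k. (\<forall>y. \<phi> y = k * u2 y) \<and> (\<kappa> \<noteq> - 3 \<longrightarrow> k = 0)"
proof -
  have vanish: "\<phi> y = 0" if "Hmat 1 3 *v y = e *\<^sub>R y" "e \<noteq> \<kappa>" for e y
    using eig [of y] that linear_scale [OF \<open>linear \<phi>\<close>] by simp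
  have "\<phi> y = \<phi> (of_lightcone 0 0 1 0 0) * u2 y" for y
  proof -
    have "y = of_lightcone (u1 y) 0 0 0 0 + of_lightcone 0 (w1 y) 0 0 0 + u2 y *\<^sub>R of_lightcone 0 0 1 0 0
        + of_lightcone 0 0 0 (w2 y) 0 + of_lightcone 0 0 0 0 (z_part y)"
      by (simp add: lightcone_eq_iff)
    from arg_cong [OF this, of \<phi>]
    have "\<phi> y = \<phi> (of_lightcone (u1 y) 0 0 0 0) + \<phi> (of_lightcone 0 (w1 y) 0 0 0) + u2 y * \<phi> (of_lightcone 0 0 1 0 0)
        + \<phi> (of_lightcone 0 0 0 (w2 y) 0) + \<phi> (of_lightcone 0 0 0 0 (z_part y))"
      by (simp only: linear_add [OF \<open>linear \<phi>\<close>] linear_scale [OF \<open>linear \<phi>\<close>] real_scaleR_def)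
    moreover have "\<phi> (of_lightcone (u1 y) 0 0 0 0) = 0"
      by (rule vanish [of _ "- 1"]) (use assms(3) in \<open>auto simp: lightcone_eq_iff\<close>)
    moreover have "\<phi> (of_lightcone 0 (w1 y) 0 0 0) = 0"
      by (rule vanish [of _ 1]) (use assms(3) in \<open>auto simp: lightcone_eq_iff\<close>)
    moreover have "\<phi> (of_lightcone 0 0 0 (w2 y) 0) = 0"
      by (rule vanish [of _ 3]) (use assms(3) in \<open>auto simp: lightcone_eq_iff\<close>)
    moreover have "\<phi> (of_lightcone 0 0 0 0 (z_part y)) = 0"
      by (rule vanish [of _ 0]) (use assms(3) in \<open>auto simp: lightcone_eq_iff\<close>)
    ultimately show ?thesis
      by simp
  qed
  moreover have "\<phi> (of_lightcone 0 0 1 0 0) = 0" if "\<kappa> \<noteq> - 3"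
    by (rule vanish [of _ "- 3"]) (use that in \<open>auto simp: lightcone_eq_iff\<close>)
  ultimately show ?thesis
    by blast
qed

text \<open>
  A root vector \<open>X\<close> for \<open>\<mu>\<close> shifts weights: if \<open>l\<close> has weight \<open>e\<close>, then \<open>l \<circ> X\<close> has weight \<open>e - \<mu>(H)\<close>. So
  \<open>l \<circ> X\<close> is zero or a multiple of \<open>u2\<close> as soon as the shifted number is none of the other weights.
\<close>

lemma root_space_functional:
  fixes X :: "'m::finite mat2n"
  assumes X: "X \<in> root_space \<mu>" and l: "linear l" "\<And>y. l (Hmat 1 3 *v y) = e * l y"
    and "e - \<mu> (Hmat 1 3) \<notin> {0, 1, - 1, 3}"
  shows "\<exists>k. (\<forall>y. l (X *v y) = k * u2 y) \<and> (e - \<mu> (Hmat 1 3) \<noteq> - 3 \<longrightarrow> k = 0)"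
proof (rule Hmat_eigenfunctional)
  let ?H = "Hmat 1 3 :: 'm mat2n"
  show "linear (\<lambda>y. l (X *v y))"
    using linear_compose [OF matrix_vector_mul_linear l(1), of X] by (simp add: o_def)
  have "bracket ?H X = \<mu> ?H *\<^sub>R X"
    using X by (auto simp: root_space_def lie_a_def)
  then have "?H *v (X *v y) - X *v (?H *v y) = \<mu> ?H *\<^sub>R (X *v y)" for y
    by (simp add: bracket_def matrix_vector_mul_assoc flip: matrix_vector_mult_diff_rdistrib scaleR_matrix_vector_assoc)
  from arg_cong [OF this, of l]
  have "l (?H *v (X *v y)) - l (X *v (?H *v y)) = \<mu> ?H * l (X *v y)" for y
    by (simp add: linear_diff [OF l(1)] linear_scale [OF l(1)])
  then show "l (X *v (?H *v y)) = (e - \<mu> ?H) * l (X *v y)" for y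
    by (simp add: l(2) algebra_simps)
qed (rule assms)

text \<open>
  At \<open>H = Hmat 1 3\<close> the positive roots take the values 2, 1, 3, 4, listed with \<open>alpha1\<close> first. Subtracting
  them from the weight \<open>-3\<close> of \<open>u2\<close> gives no weight; subtracting them from the weight \<open>-1\<close> of \<open>u1\<close> gives
  a weight only for \<open>alpha1\<close>, namely that of \<open>u2\<close>.
\<close>

lemma lie_n_action:
  assumes "X \<in> lie_n"
  shows "u2 (X *v y) = 0" "u2 y = 0 \<Longrightarrow> u1 (X *v y) = 0"
proof -
  from assms obtain A B C D where X: "X = A + B + C + D"
    and A: "A \<in> root_space alpha1" and B: "B \<in> root_space alpha2"
    and C: "C \<in> root_space (\<lambda>H. alpha1 H + alpha2 H)"
    and D: "D \<in> root_space (\<lambda>H. alpha1 H + 2 * alpha2 H)"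
    unfolding lie_n_def by (auto elim!: set_plus_elim)
  note u2_weight = root_space_functional [OF _ linear_u(2), of _ _ "- 3"]
  note u1_weight = root_space_functional [OF _ linear_u(1), of _ _ "- 1"]
  have "u2 (A *v y) = 0" "u2 (B *v y) = 0" "u2 (C *v y) = 0" "u2 (D *v y) = 0"
    using u2_weight [OF A] u2_weight [OF B] u2_weight [OF C] u2_weight [OF D] by (auto simp: alpha_Hmat)
  then show "u2 (X *v y) = 0"
    by (simp add: X matrix_vector_mult_add_rdistrib)
  assume "u2 y = 0"
  then have "u1 (A *v y) = 0" "u1 (B *v y) = 0" "u1 (C *v y) = 0" "u1 (D *v y) = 0"
    using u1_weight [OF A] u1_weight [OF B] u1_weight [OF C] u1_weight [OF D] by (auto simp: alpha_Hmat)
  then show "u1 (X *v y) = 0"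
    by (simp add: X matrix_vector_mult_add_rdistrib)
qed

text \<open>
  The additional root \<open>- alpha2\<close> shifts the weight \<open>-3\<close> of \<open>u2\<close> to \<open>-2\<close>, which is not a weight. This is
  what distinguishes \<open>\<qq>\<^sub>1\<close> from \<open>\<qq>\<^sub>2\<close>, whose root \<open>- alpha1\<close> mixes \<open>u1\<close> into \<open>u2\<close>.
\<close>

lemma lie_q1_action:
  assumes "X \<in> lie_q1"
  obtains k where "\<And>y. u2 (X *v y) = k * u2 y"
proof -
  from assms obtain K H N B where X: "X = K + H + N + B" and K: "K \<in> root_space (\<lambda>H. 0)"
    and H: "H \<in> lie_a" and N: "N \<in> lie_n" and B: "B \<in> root_space (\<lambda>H. - alpha2 H)"
    unfolding lie_q1_def lie_q0_def lie_k0_def by (auto elim!: set_plus_elim)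
  note u2_weight = root_space_functional [OF _ linear_u(2), of _ _ "- 3"]
  obtain k where "\<And>y. u2 (K *v y) = k * u2 y"
    using u2_weight [OF K] by auto
  moreover have "u2 (B *v y) = 0" for y
    using u2_weight [OF B] by (auto simp: alpha_Hmat)
  moreover obtain a b where "H = Hmat a b"
    using H by (auto simp: lie_a_def)
  ultimately have "u2 (X *v y) = (k - b) * u2 y" for y
    by (simp add: X matrix_vector_mult_add_rdistrib lie_n_action [OF N] left_diff_distrib)
  then show ?thesis
    by (rule that)
qed

section \<open>Exponentials of root vectors\<close>

lemma lie_n_mexp:
  assumes "X \<in> lie_n"
  shows "u2 (mexp X *v x) = u2 x" "u2 x = 0 \<Longrightarrow> u1 (mexp X *v x) = u1 x"
  using mexp_eigenfunctional [OF linear_u(2), of x UNIV X 0] lie_n_action [OF assms]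
    mexp_eigenfunctional [OF linear_u(1), of x "{y. u2 y = 0}" X 0]
  by simp_all

lemma Hmat_mexp:
  "u1 (mexp (Hmat a b) *v x) = exp (- a) * u1 x" "u2 (mexp (Hmat a b) *v x) = exp (- b) * u2 x"
  using mexp_eigenfunctional [OF linear_u(1), of x UNIV "Hmat a b" "- a"]
    mexp_eigenfunctional [OF linear_u(2), of x UNIV "Hmat a b" "- b"]
  by simp_all

text \<open>
  The value of \<open>u2\<close> is rescaled by a positive factor. On \<open>u2 = 0\<close> the coordinate \<open>u1\<close> need not be an
  eigenfunctional of \<open>X\<close>, since the root \<open>- alpha2\<close> mixes \<open>z_part\<close> into it, but along the curve
  \<open>t \<mapsto> exp (t X) x\<close> in \<open>AdS\<close> it never vanishes and so keeps its sign.
\<close>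

lemma lie_q1_mexp:
  assumes "X \<in> lie_q1" "x \<in> AdS"
  shows "sgn (u2 (mexp X *v x)) = sgn (u2 x)" "u2 x = 0 \<Longrightarrow> sgn (u1 (mexp X *v x)) = sgn (u1 x)"
proof -
  from lie_q1_action [OF assms(1)] obtain k where k: "\<And>y. u2 (X *v y) = k * u2 y"
    by metis
  have scale: "u2 (mexp (t *\<^sub>R X) *v x) = exp (t * k) * u2 x" for t
    by (rule mexp_eigenfunctional [OF linear_u(2), of x UNIV])
      (simp_all add: k flip: scaleR_matrix_vector_assoc)
  show "sgn (u2 (mexp X *v x)) = sgn (u2 x)"
    using scale [of 1] by (simp add: sgn_mult)
  assume "u2 x = 0"
  have so: "X \<in> so2n"
    using assms(1) lie_subset_so2n by blast
  define f where "f t = u1 (mexp (t *\<^sub>R X) *v x)" for t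
  have nonzero: "f t \<noteq> 0" for t
    unfolding f_def using scale [of t] \<open>u2 x = 0\<close> assms(2)
    by (intro AdS_u_nonzero) (simp_all add: SO0_AdS mexp_in_SO0 so2n_scaleR so)
  have "continuous_on UNIV f"
    unfolding f_def u1_def
    by (intro continuous_on_diff; rule DERIV_continuous_on [OF has_field_derivative_at_within [OF mexp_vec_deriv]])
  then have conn: "connected (range f)"
    by (rule connected_continuous_image) simp
  have "sgn (f 1) = sgn (f 0)"
  proof (rule ccontr)
    assume "sgn (f 1) \<noteq> sgn (f 0)"
    with nonzero [of 0] nonzero [of 1] have "f 0 < 0 \<and> 0 < f 1 \<or> f 1 < 0 \<and> 0 < f 0"
      by (auto simp: sgn_if split: if_splits)
    then have "0 \<in> range f"
      using connectedD_interval [OF conn, of "f 0" "f 1" 0] connectedD_interval [OF conn, of "f 1" "f 0" 0]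
      by auto
    then show False
      using nonzero by (metis rangeE)
  qed
  then show "sgn (u1 (mexp X *v x)) = sgn (u1 x)"
    by (simp add: f_def mexp_0)
qed

text \<open>
  The third power of each of these root vectors vanishes, so the series stops at the quadratic term.
\<close>

lemma root_elt_mexp:
  "u1 (mexp (root_elt 0 b 0 0 0) *v x) = u1 x + b * u2 x"
  "u2 (mexp (root_elt 0 b 0 0 0) *v x) = u2 x"
  "z_part (mexp (root_elt 0 b 0 0 0) *v x) = z_part x"
  "u1 (mexp (root_elt 0 0 v 0 0) *v x) = u1 x"
  "u2 (mexp (root_elt 0 0 v 0 0) *v x) = u2 x"
  "z_part (mexp (root_elt 0 0 v 0 0) *v x) = z_part x + u1 x *\<^sub>R v"
  "u2 (mexp (root_elt 0 0 0 w 0) *v x) = u2 x"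
  "z_part (mexp (root_elt 0 0 0 w 0) *v x) = z_part x + u2 x *\<^sub>R w"
  "u1 (mexp (root_elt a 0 0 0 0) *v x) = u1 x"
  "w1 (mexp (root_elt a 0 0 0 0) *v x) = w1 x + a * u2 x"
  "u2 (mexp (root_elt a 0 0 0 0) *v x) = u2 x"
  "w2 (mexp (root_elt a 0 0 0 0) *v x) = w2 x - a * u1 x"
  "z_part (mexp (root_elt a 0 0 0 0) *v x) = z_part x"
  "u2 (mexp (root_elt 0 0 0 0 c) *v x) = u2 x + c * u1 x"
  by (subst mexp_nilpotent; simp add: root_elt_vec lightcone_eq_iff)+

section \<open>The orbits of N\<close>

lemma root_elt_mexp_in_N:
  "mexp (root_elt 0 b 0 0 0) \<in> grp_N" "mexp (root_elt 0 0 v 0 0) \<in> grp_N"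
  "mexp (root_elt 0 0 0 w 0) \<in> grp_N" "mexp (root_elt a 0 0 0 0) \<in> grp_N"
  unfolding grp_N_def
  using root_elt_in_root_space root_spaces_subset_lie_n mexp_in_connected_Lie_subgroup by blast+

lemma subgroup_grps:
  shows "subgroup (grp_A :: 'm::finite mat2n set) SO0_group" "subgroup (grp_N :: 'm mat2n set) SO0_group"
    "subgroup (grp_Q0 :: 'm mat2n set) SO0_group" "subgroup (grp_Q1 :: 'm mat2n set) SO0_group"
    "subgroup (grp_Q2 :: 'm mat2n set) SO0_group"
  unfolding grp_A_def grp_N_def grp_Q0_def grp_Q1_def grp_Q2_def
  by (intro connected_Lie_subgroup_is_subgroup lie_a_so2n lie_subset_so2n)+

lemma subgroup_mult: "subgroup G SO0_group \<Longrightarrow> g \<in> G \<Longrightarrow> h \<in> G \<Longrightarrow> g ** h \<in> G"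
  using subgroup.m_closed [of G SO0_group g h] by simp

lemma subgroup_mult_vec:
  assumes "subgroup G SO0_group" "g \<in> G" "h \<in> G"
  shows "\<exists>k\<in>G. k *v x = g *v (h *v x)"
  using subgroup_mult [OF assms] by (auto simp: matrix_vector_mul_assoc)

lemma subgroup_inv_vec:
  assumes "subgroup G SO0_group" "g \<in> G" "g *v x = y"
  shows "\<exists>k\<in>G. k *v y = x"
  using subgroup.m_inv_closed [OF assms(1,2)] SO0_inv_vec(1) [OF subgroup.mem_carrier [OF assms(1,2)], of x]
    assms(3) by blast

lemma subgroup_AdS: "subgroup G SO0_group \<Longrightarrow> g \<in> G \<Longrightarrow> g *v x \<in> AdS \<longleftrightarrow> x \<in> AdS"
  by (rule SO0_AdS) (rule subgroup.mem_carrier)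

text \<open>
  The complete invariant of the \<open>N\<close>-orbits in \<open>AdS\<close>. The second component is 0 where \<open>u2 \<noteq> 0\<close> because
  \<open>N\<close> moves \<open>u1\<close> there.
\<close>

definition level :: "'m::finite vec2n \<Rightarrow> real \<times> real" where
  "level x = (u2 x, if u2 x = 0 then u1 x else 0)"

text \<open>
  The point of \<open>AdS\<close> on the level \<open>l\<close> whose coordinates \<open>z_part\<close>, and \<open>u1\<close>, \<open>w1\<close> or \<open>w2\<close> as far as the
  level leaves them free, are zero. One component of a level is 0, and \<open>1 / 0 = 0\<close> then gives the right
  coordinate.
\<close>

definition base_point :: "real \<times> real \<Rightarrow> 'm::finite vec2n" where
  "base_point l = of_lightcone (snd l) (1 / snd l) (fst l) (1 / fst l) 0"

text \<open>
  Successive exponentials of root vectors clear the coordinates: first \<open>z_part\<close>, then, if \<open>u2 \<noteq> 0\<close>, \<open>u1\<close>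
  and \<open>w1\<close>, and otherwise \<open>w2\<close>. The remaining coordinate follows from the equation of \<open>AdS\<close>.
\<close>

lemma N_reaches_base_point:
  assumes "x \<in> AdS"
  shows "\<exists>g\<in>grp_N. g *v x = base_point (level x)"
proof (cases "u2 x = 0")
  case True
  with assms have "u1 x \<noteq> 0"
    by (rule AdS_u_nonzero)
  let ?g = "mexp (root_elt 0 0 (- (1 / u1 x) *\<^sub>R z_part x) 0 0)"
  let ?h = "mexp (root_elt (w2 (?g *v x) / u1 x) 0 0 0 0)"
  let ?y = "?h *v (?g *v x)"
  have "?y \<in> AdS"
    using assms by (simp add: subgroup_AdS [OF subgroup_grps(2)] root_elt_mexp_in_N)
  moreover have y: "u1 ?y = u1 x" "u2 ?y = 0" "w2 ?y = 0" "z_part ?y = 0"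
    using True \<open>u1 x \<noteq> 0\<close> by (simp_all add: root_elt_mexp)
  ultimately have "w1 ?y = 1 / u1 x"
    using \<open>u1 x \<noteq> 0\<close> unfolding AdS_lightcone by (simp add: field_simps)
  then have "?y = base_point (level x)"
    using True y unfolding lightcone_eq_iff by (simp add: base_point_def level_def)
  then show ?thesis
    by (intro bexI [of _ "?h ** ?g"])
      (simp_all add: subgroup_mult [OF subgroup_grps(2)] root_elt_mexp_in_N flip: matrix_vector_mul_assoc)
next
  case False
  let ?g = "mexp (root_elt 0 0 0 (- (1 / u2 x) *\<^sub>R z_part x) 0)"
  let ?h = "mexp (root_elt 0 (- u1 (?g *v x) / u2 x) 0 0 0)"
  let ?k = "mexp (root_elt (- w1 (?h *v (?g *v x)) / u2 x) 0 0 0 0)"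
  let ?y = "?k *v (?h *v (?g *v x))"
  have "?y \<in> AdS"
    using assms by (simp add: subgroup_AdS [OF subgroup_grps(2)] root_elt_mexp_in_N)
  moreover have y: "u1 ?y = 0" "u2 ?y = u2 x" "w1 ?y = 0" "z_part ?y = 0"
    using False by (simp_all add: root_elt_mexp)
  ultimately have "w2 ?y = 1 / u2 x"
    using False unfolding AdS_lightcone by (simp add: field_simps)
  then have "?y = base_point (level x)"
    using False y unfolding lightcone_eq_iff by (simp add: base_point_def level_def)
  then show ?thesis
    by (intro bexI [of _ "?k ** (?h ** ?g)"])
      (simp_all add: subgroup_mult [OF subgroup_grps(2)] root_elt_mexp_in_N flip: matrix_vector_mul_assoc)
qed

lemma N_transitive_on_levels:
  assumes "x \<in> AdS" "y \<in> AdS" "level x = level y"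
  shows "\<exists>g\<in>grp_N. g *v x = y"
proof -
  obtain g where g: "g \<in> grp_N" "g *v x = base_point (level x)"
    using N_reaches_base_point [OF assms(1)] by blast
  obtain h where "h \<in> grp_N" "h *v y = base_point (level x)"
    using N_reaches_base_point [OF assms(2)] assms(3) by auto
  then obtain k where "k \<in> grp_N" "k *v base_point (level x) = y"
    using subgroup_inv_vec [OF subgroup_grps(2)] by blast
  then show ?thesis
    using subgroup_mult_vec [OF subgroup_grps(2) _ g(1), of k x] g(2) by auto
qed

lemma N_preserves_level: "g \<in> grp_N \<Longrightarrow> x \<in> AdS \<Longrightarrow> level (g *v x) = level x"
  unfolding grp_N_def
  by (rule invariant_of_generators [OF _ lie_subset_so2n(1)])
    (auto simp: level_def lie_n_mexp)

lemma orbit_N: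
  assumes "x \<in> AdS"
  shows "orbit (subgrp grp_N) AdS_act x = {y \<in> AdS. level y = level x}"
  using assms N_preserves_level [OF _ assms] N_transitive_on_levels [OF assms]
  by (auto simp: orbit_AdS subgroup_AdS [OF subgroup_grps(2)]) metis

lemma Obar_eq:
  assumes "r \<noteq> 0"
  shows "Obar r = {x :: 'm::finite vec2n. x \<in> AdS \<and> u2 x = r}"
  unfolding Obar_def
proof (rule the_equality)
  let ?p = "base_point (r, 0) :: 'm vec2n"
  have p: "?p \<in> AdS" "u2 ?p = r"
    using assms by (auto simp: AdS_lightcone base_point_def)
  have orb: "orbit (subgrp grp_N) AdS_act p = {x \<in> AdS. u2 x = r}" if "p \<in> AdS" "u2 p = r" for p :: "'m vec2n"
    using that assms by (auto simp: orbit_N level_def)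
  show "\<exists>p\<in>AdS. p $ I2 - p $ I4 = r \<and> {x :: 'm vec2n. x \<in> AdS \<and> u2 x = r} = orbit (subgrp grp_N) AdS_act p"
  proof (rule bexI [of _ ?p])
    show "?p $ I2 - ?p $ I4 = r
        \<and> {x :: 'm vec2n. x \<in> AdS \<and> u2 x = r} = orbit (subgrp grp_N) AdS_act ?p"
      using orb [OF p] p(2) by (simp add: u2_def)
  qed (rule p)
  show "S = {x :: 'm vec2n. x \<in> AdS \<and> u2 x = r}"
    if "\<exists>p\<in>AdS. p $ I2 - p $ I4 = r \<and> S = orbit (subgrp grp_N) AdS_act p" for S
    using that orb by (auto simp: u2_def)
qed

lemma Orb_eq:
  assumes "s \<noteq> 0"
  shows "Orb s = {x :: 'm::finite vec2n. x \<in> AdS \<and> u2 x = 0 \<and> u1 x = s}"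
  unfolding Orb_def
proof (rule the_equality)
  let ?p = "base_point (0, s) :: 'm vec2n"
  have p: "?p \<in> AdS" "u2 ?p = 0" "u1 ?p = s"
    using assms by (auto simp: AdS_lightcone base_point_def)
  have orb: "orbit (subgrp grp_N) AdS_act p = {x \<in> AdS. u2 x = 0 \<and> u1 x = s}"
    if "p \<in> AdS" "u2 p = 0" "u1 p = s" for p :: "'m vec2n"
    using that by (auto simp: orbit_N level_def split: if_splits)
  show "\<exists>p\<in>AdS. p $ I2 = p $ I4 \<and> p $ I1 - p $ I3 = s
      \<and> {x :: 'm vec2n. x \<in> AdS \<and> u2 x = 0 \<and> u1 x = s} = orbit (subgrp grp_N) AdS_act p"
  proof (rule bexI [of _ ?p])
    show "?p $ I2 = ?p $ I4 \<and> ?p $ I1 - ?p $ I3 = s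
        \<and> {x :: 'm vec2n. x \<in> AdS \<and> u2 x = 0 \<and> u1 x = s} = orbit (subgrp grp_N) AdS_act ?p"
      using orb [OF p] p(2,3) by (simp add: u2_def u1_def)
  qed (rule p)
  show "S = {x :: 'm vec2n. x \<in> AdS \<and> u2 x = 0 \<and> u1 x = s}"
    if "\<exists>p\<in>AdS. p $ I2 = p $ I4 \<and> p $ I1 - p $ I3 = s \<and> S = orbit (subgrp grp_N) AdS_act p" for S
    using that orb by (auto simp: u2_def u1_def)
qed

section \<open>The orbits of AN and of the parabolic subgroups\<close>

definition level_sign :: "'m::finite vec2n \<Rightarrow> real \<times> real" where
  "level_sign x = (sgn (u2 x), if u2 x = 0 then sgn (u1 x) else 0)"

lemma four_pieces:
  "O_plus = {x \<in> AdS. level_sign x = (0, 1)}" "O_minus = {x \<in> AdS. level_sign x = (0, - 1)}"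
  "Obar_plus = {x \<in> AdS. level_sign x = (1, 0)}" "Obar_minus = {x \<in> AdS. level_sign x = (- 1, 0)}"
  by (auto simp: O_plus_def O_minus_def Obar_plus_def Obar_minus_def Orb_eq Obar_eq level_sign_def
      sgn_if split: if_splits)

lemma level_sign_cases:
  "x \<in> AdS \<Longrightarrow> level_sign x \<in> {(0, 1), (0, - 1), (1, 0), (- 1, 0)}"
  using AdS_u_nonzero [of x] by (auto simp: level_sign_def sgn_if)

lemma base_point_level_sign:
  assumes "l \<in> {(0, 1), (0, - 1), (1, 0), (- 1, 0)}"
  shows "(base_point l :: 'm::finite vec2n) \<in> AdS" "level_sign (base_point l :: 'm vec2n) = l"
  using assms by (auto simp: AdS_lightcone base_point_def level_sign_def)

lemma distinct_pieces: "distinct [O_plus, O_minus, Obar_plus, Obar_minus :: 'm::finite vec2n set]"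
proof -
  let ?F = "\<lambda>l. {x :: 'm vec2n. x \<in> AdS \<and> level_sign x = l}"
  have "inj_on ?F {(0, 1), (0, - 1), (1, 0), (- 1, 0)}"
  proof (rule inj_onI)
    fix l l' assume l: "l \<in> {(0, 1), (0, - 1), (1, 0), (- 1, 0)}" and "?F l = ?F l'"
    then have "base_point l \<in> ?F l'"
      using base_point_level_sign [OF l] by blast
    then show "l = l'"
      using base_point_level_sign(2) [OF l, where 'm = 'm] by simp
  qed
  then have "distinct (map ?F [(0, 1), (0, - 1), (1, 0), (- 1, 0)])"
    by (simp only: distinct_map) simp
  then show ?thesis
    by (simp only: four_pieces list.map)
qed

lemma orbits_eq_pieces:
  fixes G :: "'m::finite mat2n set"
  assumes "\<And>x. x \<in> AdS \<Longrightarrow> orbit (subgrp G) AdS_act x = {y \<in> AdS. level_sign y = level_sign x}"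
  shows "orbits (subgrp G) AdS AdS_act = {O_plus, O_minus, Obar_plus, Obar_minus}"
proof -
  let ?L = "{(0, 1), (0, - 1), (1, 0), (- 1, 0)} :: (real \<times> real) set"
  have "level_sign ` (AdS :: 'm vec2n set) = ?L"
  proof (intro equalityI subsetI)
    fix l assume l: "l \<in> ?L"
    show "l \<in> level_sign ` (AdS :: 'm vec2n set)"
      using base_point_level_sign [OF l, where 'm = 'm] by (metis imageI)
  qed (use level_sign_cases in blast)
  moreover have "orbits (subgrp G) AdS AdS_act = (\<lambda>l. {y \<in> AdS. level_sign y = l})
      ` level_sign ` (AdS :: 'm vec2n set)"
    unfolding orbits_def image_image setcompr_eq_image Collect_mem_eq
    by (rule image_cong [OF refl assms])
  ultimately show ?thesis
    by (simp add: four_pieces)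
qed

text \<open>
  The group \<open>A\<close> rescales the level of \<open>y\<close> by any positive factor, so it can be brought to the level of
  \<open>x\<close>; there \<open>N\<close> is transitive.
\<close>

lemma AN_transitive_on_level_signs:
  assumes "x \<in> AdS" "y \<in> AdS" "level_sign x = level_sign y"
  shows "\<exists>g\<in>grp_AN. g *v x = y"
proof -
  \<comment> \<open>\<open>exp (- a)\<close> and \<open>exp (- b)\<close> are the factors that turn the level of \<open>y\<close> into that of \<open>x\<close>.\<close>
  define a where "a = (if u2 x = 0 then ln (u1 y / u1 x) else 0)"
  define b where "b = (if u2 x = 0 then 0 else ln (u2 y / u2 x))"
  let ?h = "mexp (Hmat a b) :: 'a mat2n"
  have h: "?h \<in> grp_A"
    unfolding grp_A_def by (rule mexp_in_connected_Lie_subgroup) (auto simp: lie_a_def)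
  have pos: "v / u > 0" if "sgn u = sgn v" "u \<noteq> 0" for u v :: real
    using that by (auto simp: sgn_if zero_less_divide_iff split: if_splits)
  have "level (?h *v y) = level x"
  proof (cases "u2 x = 0")
    case True
    with assms have "u2 y = 0" "sgn (u1 x) = sgn (u1 y)" "u1 x \<noteq> 0"
      using AdS_u_nonzero by (auto simp: level_sign_def sgn_if split: if_splits)
    then show ?thesis
      using True pos [of "u1 x" "u1 y"] by (auto simp: level_def Hmat_mexp a_def exp_minus)
  next
    case False
    with assms have "sgn (u2 x) = sgn (u2 y)" "u2 y \<noteq> 0"
      by (auto simp: level_sign_def sgn_if split: if_splits)
    then show ?thesis
      using False pos [of "u2 x" "u2 y"] by (auto simp: level_def Hmat_mexp b_def exp_minus)
  qed
  moreover have "?h *v y \<in> AdS"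
    using h assms(2) by (simp add: subgroup_AdS [OF subgroup_grps(1)])
  ultimately obtain n where n: "n \<in> grp_N" "n *v x = ?h *v y"
    using N_transitive_on_levels [OF assms(1)] by metis
  obtain k where k: "k \<in> grp_A" "k *v (?h *v y) = y"
    using subgroup_inv_vec [OF subgroup_grps(1) h] by blast
  have "k ** n \<in> grp_AN"
    using k(1) n(1) by (auto simp: grp_AN_def set_mult_def)
  moreover have "(k ** n) *v x = y"
    using k(2) n(2) by (simp flip: matrix_vector_mul_assoc)
  ultimately show ?thesis
    by blast
qed

lemma Q1_preserves_level_sign:
  "g \<in> grp_Q1 \<Longrightarrow> x \<in> AdS \<Longrightarrow> level_sign (g *v x) = level_sign x"
  unfolding grp_Q1_def
proof (rule invariant_of_generators [OF _ lie_subset_so2n(3)])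
  fix X :: "'a mat2n" and x :: "'a vec2n" assume *: "X \<in> lie_q1" "x \<in> AdS"
  have "u2 (mexp X *v x) = 0 \<longleftrightarrow> u2 x = 0"
    using lie_q1_mexp(1) [OF *] by (metis sgn_0_0)
  then show "level_sign (mexp X *v x) = level_sign x"
    using lie_q1_mexp [OF *] by (auto simp: level_sign_def)
qed

lemma group_inclusions:
  shows "(grp_AN :: 'm::finite mat2n set) \<subseteq> grp_Q0" "(grp_Q0 :: 'm mat2n set) \<subseteq> grp_Q1"
    "(grp_N :: 'm mat2n set) \<subseteq> grp_Q2"
proof -
  have A: "(grp_A :: 'm mat2n set) \<subseteq> grp_Q0" and N: "(grp_N :: 'm mat2n set) \<subseteq> grp_Q0"
    unfolding grp_A_def grp_N_def grp_Q0_def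
    using connected_Lie_subgroup_mono [OF lie_inclusions(1)] connected_Lie_subgroup_mono [OF lie_inclusions(2)]
      lie_subset_so2n by blast+
  show "(grp_AN :: 'm mat2n set) \<subseteq> grp_Q0"
  proof
    fix g :: "'m mat2n" assume "g \<in> grp_AN"
    then obtain h k where "g = h ** k" "h \<in> grp_A" "k \<in> grp_N"
      by (auto simp: grp_AN_def set_mult_def)
    then show "g \<in> grp_Q0"
      using A N subgroup.m_closed [OF subgroup_grps(3), of h k] by auto
  qed
  show "(grp_Q0 :: 'm mat2n set) \<subseteq> grp_Q1"
    unfolding grp_Q0_def grp_Q1_def
    by (rule connected_Lie_subgroup_mono [OF lie_inclusions(3)])
  have "(grp_Q0 :: 'm mat2n set) \<subseteq> grp_Q2"
    unfolding grp_Q0_def grp_Q2_def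
    by (rule connected_Lie_subgroup_mono [OF lie_inclusions(4)])
  with N show "(grp_N :: 'm mat2n set) \<subseteq> grp_Q2"
    by blast
qed

text \<open>
  The lower bound comes from \<open>AN\<close> and the upper bound from \<open>Q\<^sub>1\<close>, hence the orbits of every group in
  between are the same.
\<close>

lemma orbit_eq_level_sign_fibre:
  fixes x :: "'m::finite vec2n"
  assumes "x \<in> AdS" "grp_AN \<subseteq> G" "G \<subseteq> grp_Q1"
  shows "orbit (subgrp G) AdS_act x = {y \<in> AdS. level_sign y = level_sign x}"
  unfolding orbit_AdS [OF assms(1)]
proof (intro equalityI subsetI)
  fix y assume "y \<in> {g *v x | g. g \<in> G}"
  then obtain g where "g \<in> grp_Q1" "y = g *v x"
    using assms(3) by blast
  then show "y \<in> {y \<in> AdS. level_sign y = level_sign x}"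
    using assms(1) by (simp add: Q1_preserves_level_sign subgroup_AdS [OF subgroup_grps(4)])
next
  fix y :: "'m vec2n" assume "y \<in> {y \<in> AdS. level_sign y = level_sign x}"
  then obtain g where "g \<in> grp_AN" "g *v x = y"
    using AN_transitive_on_level_signs [OF assms(1)] by force
  then show "y \<in> {g *v x | g. g \<in> G}"
    using assms(2) by blast
qed

text \<open>
  On the pair \<open>(u1, u2)\<close> the root vectors for \<open>\<plusminus> alpha1\<close> act by elementary transvections, which are
  transitive on nonzero vectors. So \<open>u2 = 1\<close> can be reached, and this is a single \<open>N\<close>-orbit.
\<close>

lemma Q2_reaches_base_point:
  assumes "x \<in> AdS"
  shows "\<exists>g\<in>grp_Q2. g *v x = base_point (1, 0)"
proof -
  have opp: "mexp (root_elt 0 0 0 0 c) \<in> grp_Q2" for c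
    unfolding grp_Q2_def
    using root_elt_in_root_space(5) lie_inclusions(5) mexp_in_connected_Lie_subgroup by blast
  obtain g where g: "g \<in> grp_Q2" "u2 (g *v x) = 1"
  proof (cases "u2 x = 0")
    case True
    with assms have "u1 x \<noteq> 0"
      by (rule AdS_u_nonzero)
    with True show ?thesis
      by (intro that [of "mexp (root_elt 0 0 0 0 (1 / u1 x))"] opp) (simp add: root_elt_mexp)
  next
    case False
    let ?h = "mexp (root_elt 0 ((1 - u1 x) / u2 x) 0 0 0) :: 'a mat2n"
    let ?k = "mexp (root_elt 0 0 0 0 (1 - u2 x)) :: 'a mat2n"
    have "?h \<in> grp_Q2"
      using root_elt_mexp_in_N(1) group_inclusions(3) by blast
    then obtain g where "g \<in> grp_Q2" "g *v x = ?k *v (?h *v x)"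
      using subgroup_mult_vec [OF subgroup_grps(5) opp] by blast
    moreover have "u2 (?k *v (?h *v x)) = 1"
      using False by (simp add: root_elt_mexp)
    ultimately show ?thesis
      by (intro that [of g]) simp_all
  qed
  have "g *v x \<in> AdS"
    using assms g(1) by (simp add: subgroup_AdS [OF subgroup_grps(5)])
  moreover have "level (g *v x) = (1, 0)"
    using g(2) by (simp add: level_def)
  ultimately obtain n where "n \<in> grp_N" "n *v (g *v x) = base_point (1, 0)"
    using N_reaches_base_point by metis
  then show ?thesis
    using subgroup_mult_vec [OF subgroup_grps(5) _ g(1), of n x] group_inclusions(3) by auto
qed

lemma Q2_transitive:
  assumes "x \<in> AdS" "y \<in> AdS"
  shows "\<exists>g\<in>grp_Q2. g *v x = y"
proof -
  obtain g where g: "g \<in> grp_Q2" "g *v x = base_point (1, 0)"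
    using Q2_reaches_base_point [OF assms(1)] by blast
  obtain h where "h \<in> grp_Q2" "h *v y = base_point (1, 0)"
    using Q2_reaches_base_point [OF assms(2)] by blast
  then obtain k where "k \<in> grp_Q2" "k *v base_point (1, 0) = y"
    using subgroup_inv_vec [OF subgroup_grps(5)] by blast
  then show ?thesis
    using subgroup_mult_vec [OF subgroup_grps(5) _ g(1), of k x] g(2) by auto
qed

theorem proposition4p3:
  fixes n :: nat
  assumes "n \<ge> 3" and "CARD('m::finite) = n - 2"
  shows "(\<forall>Q \<in> {grp_Q0, grp_Q1, grp_Q2 :: 'm mat2n set}.
           subgroup Q SO0_group \<and> acts_isometrically Q \<and> cohomogeneity Q = 0)
     \<and> transitive_action (subgrp (grp_Q2 :: 'm mat2n set)) AdS AdS_act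
     \<and> orbits (subgrp (grp_Q0 :: 'm mat2n set)) AdS AdS_act = {O_plus, O_minus, Obar_plus, Obar_minus}
     \<and> orbits (subgrp (grp_Q1 :: 'm mat2n set)) AdS AdS_act = {O_plus, O_minus, Obar_plus, Obar_minus}
     \<and> orbits (subgrp (grp_AN :: 'm mat2n set)) AdS AdS_act = {O_plus, O_minus, Obar_plus, Obar_minus}
     \<and> distinct [O_plus, O_minus, Obar_plus, Obar_minus :: 'm vec2n set]"
proof -
  \<comment> \<open>A point of the orbit \<open>u2 > 0\<close>, which is open in \<open>AdS\<close>.\<close>
  let ?p = "base_point (1, 0) :: 'm vec2n"
  have p: "?p \<in> AdS" "u2 ?p = 1" "level_sign ?p = (1, 0)"
    using base_point_level_sign [of "(1, 0)"] by (auto simp: base_point_def)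
  have orbit: "orbit (subgrp G) AdS_act x = {y \<in> AdS. level_sign y = level_sign x}"
    if "x \<in> AdS" "G \<in> {grp_AN, grp_Q0, grp_Q1}" for G and x :: "'m vec2n"
    using that group_inclusions [where 'm = 'm] by (intro orbit_eq_level_sign_fibre) auto
  have "cohomogeneity G = 0" if "G \<in> {grp_Q0, grp_Q1}" for G :: "'m mat2n set"
  proof (rule cohomogeneity_zero [OF p(1)])
    show "open {x :: 'm vec2n. 0 < u2 x}"
      unfolding u2_def by (intro open_Collect_less continuous_intros)
    show "orbit (subgrp G) AdS_act ?p = {x. 0 < u2 x} \<inter> AdS"
      using that p orbit [of ?p G] by (auto simp: level_sign_def sgn_if split: if_splits)
  qed (simp add: p)
  moreover have "cohomogeneity (grp_Q2 :: 'm mat2n set) = 0"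
  proof (rule cohomogeneity_zero [OF p(1)])
    show "orbit (subgrp grp_Q2) AdS_act ?p = UNIV \<inter> AdS"
      unfolding orbit_AdS [OF p(1)]
    proof (intro equalityI subsetI)
      fix y assume "y \<in> {g *v ?p | g. g \<in> grp_Q2}"
      then show "y \<in> UNIV \<inter> AdS"
        using p(1) by (auto simp: subgroup_AdS [OF subgroup_grps(5)])
    next
      fix y :: "'m vec2n" assume "y \<in> UNIV \<inter> AdS"
      then show "y \<in> {g *v ?p | g. g \<in> grp_Q2}"
        using Q2_transitive [OF p(1), of y] by blast
    qed
  qed simp_all
  ultimately have "\<forall>Q \<in> {grp_Q0, grp_Q1, grp_Q2 :: 'm mat2n set}.
      subgroup Q SO0_group \<and> acts_isometrically Q \<and> cohomogeneity Q = 0"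
    using acts_isometrically_subgroup [OF subgroup_grps(3)] acts_isometrically_subgroup [OF subgroup_grps(4)]
      acts_isometrically_subgroup [OF subgroup_grps(5)]
    by (simp add: subgroup_grps)
  moreover have "transitive_action (subgrp (grp_Q2 :: 'm mat2n set)) AdS AdS_act"
  proof (intro transitive_action.intro transitive_action_axioms.intro)
    show "group_action (subgrp (grp_Q2 :: 'm mat2n set)) AdS AdS_act"
      by (rule group_action_AdS [OF subgroup_grps(5)])
    show "\<exists>g\<in>carrier (subgrp grp_Q2). AdS_act g x = y" if "x \<in> AdS" "y \<in> AdS" for x y :: "'m vec2n"
      using Q2_transitive [OF that] that(1) by (simp add: AdS_act_def)
  qed
  moreover have "orbits (subgrp G) AdS AdS_act = {O_plus, O_minus, Obar_plus, Obar_minus}"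
    if "G \<in> {grp_AN, grp_Q0, grp_Q1}" for G :: "'m mat2n set"
    using orbit that by (intro orbits_eq_pieces) blast
  ultimately show ?thesis
    using distinct_pieces by blast
qed

end
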